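(* Let $W$ be the dihedral group generated by involutions $s,t$ with $st$ of finite order $m\ge2$, and fix a balanced symmetric realization over $\Bbbk$ satisfying Demazure surjectivity, local non-degeneracy and lesser invertibility. Equip $R^s\subset R$ and $R^t\subset R$ with the traces $\partial_s,\partial_t$, $R^W\subset R$ with $\partial_W=\partial_s\partial_t\cdots$ ($m$ factors), $R^W\subset R^s$ with $\partial^s_W$ = the composite of $m-1$ alternating Demazure operators in which $\partial_t$ is applied first (so $\partial_W=\partial^s_W\circ\partial_s$), and $R^W\subset R^t$ with $\partial^t_W$ defined symmetrically (so $\partial_W=\partial^t_W\circ\partial_t$). Then $R^W\subset R^s,R^t\subset R$ is a (compatible) graded Frobenius square. Consequently $R(m)$ is a free graded $R^W$-module of graded rank $[W]$, and for $i\in\{s,t\}$, $R^i(m-1)$ is a free graded $R^W$-module of graded rank $[W]/(v+v^{-1})$. Moreover, for any choice of dual bases the following hold: (1) $\Lambda_W=\Lambda$; (2) $\partial_W(\Lambda)=2m$; (3) $\Lambda^s_W=\Lambda/\alpha_s$; (4) $\partial^s_W(\Lambda^s_W)=m$; (5) $\Delta^s_{W(1)}\,\partial_t(\Delta^s_{W(2)})=\partial_t(\Delta^s_{W(1)})\,\Delta^s_{W(2)}=\frac{\Lambda}{\alpha_s\alpha_t}$ (where elements of $R^s$ are regarded in $R$ to apply $\partial_t$); (6) for every $f\in R$, $\Delta^s_{W(1)}\otimes\partial_t(f\Delta^s_{W(2)})=\partial_s(f\Delta^t_{W(1)})\otimes\Delta^t_{W(2)}$ in $R^s\otimes_{R^W}R^t$.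 In particular the map $R\to R^s\otimes_{R^W}R^t$, $f\mapsto\Delta^s_{W(1)}\otimes\partial_t(f\Delta^s_{W(2)})=\partial_s(f\Delta^t_{W(1)})\otimes\Delta^t_{W(2)}$, is well-defined, left $R^s$-linear and right $R^t$-linear.
   Context: Quantum numbers: $[0]=0,[1]=1,[k+1]=[2][k]-[k-1]$ for a fixed $[2]\in\Bbbk$. Balanced symmetric realization: free finite-rank $\mathfrak h$ with $\alpha_s^\vee,\alpha_t^\vee\in\mathfrak h$, $\alpha_s,\alpha_t\in\mathfrak h^*$, $\langle\alpha_u^\vee,\alpha_u\rangle=2$, $\langle\alpha_s^\vee,\alpha_t\rangle=\langle\alpha_t^\vee,\alpha_s\rangle=-[2]$, $[m]=0$, $[m-1]=1$, and $u(x)=x-\langle x,\alpha_u\rangle\alpha_u^\vee$ defines a $W$-action on $\mathfrak h$ (hence on $\mathfrak h^*$ and $R=\mathrm{Sym}(\mathfrak h^* )$, graded with $\mathfrak h^*$ in degree 2). $R^J$: invariants of the subgroup generated by $J$; $R^W=R^{\{s,t\}}$. Demazure surjectivity: $\langle-,\alpha_u\rangle\colon\mathfrak h\to\Bbbk$ and $\langle\alpha_u^\vee,-\rangle\colon\mathfrak h^*\to\Bbbk$ surjective for $u=s,t$; then $\partial_u(f)=(f-u(f))/\alpha_u$ defines $\partial_u\colon R\to R^u$. Local non-degeneracy: $4-[2]^2$ invertible. Lesser invertibility: $[k]$ invertible for $1\le k<m$, and $s,t$ act with order 2 and $st$ with order $m$. A Frobenius extension $A\subset B$ of commutative rings with trace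 $\partial\colon B\to A$: $B$ is free of finite rank over $A$, $\partial$ is $A$-linear and the pairing $(f,g)\mapsto\partial(fg)$ is perfect, i.e. there are bases $\{f_i\},\{f_i^*\}$ of $B$ over $A$ with $\partial(f_if_j^* )=\delta_{ij}$. Its comultiplication element is $\Delta=\sum_i f_i\otimes f_i^*\in B\otimes_AB$ (independent of the bases), written in Sweedler notation $\Delta_{(1)}\otimes\Delta_{(2)}$, and $\Lambda=\mu(\Delta)=\sum_if_if_i^*\in B$. We write $\Delta_W,\Lambda_W$ for $R^W\subset R$, $\Delta^s_W,\Lambda^s_W$ for $R^W\subset R^s$, $\Delta^t_W,\Lambda^t_W$ for $R^W\subset R^t$. A compatible Frobenius square means all four edge extensions are Frobenius with the given traces and the composite traces agree: $\partial^s_W\partial_s=\partial^t_W\partial_t=\partial_W$. Graded rank of a free graded module with homogeneous basis $\{b_i\}$ is $\sum_iv^{\deg b_i}$; $M(k)^i=M^{i+k}$. $[W]=v^{-m}\sum_{w\in W}v^{2\ell(w)}$. Roots: for $k\ge0$ let $f_{s,k}=x(\alpha_s)$ where $x\in W$ is the alternating product of $s,t$ of length $k$ whose rightmost letter is $t$, and $f_{t,k}$ likewise with $s,t$ swapped. $\Lambda$ is the product of the positive roots: if $m=2k$, $\Lambda=\prod_{l=0}^{k-1}f_{s,l}f_{t,l}$; if $m$ is odd, $\Lambda=\prod_{l=0}^{m-1}f_{s,l}$. *)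

theory Defs
  imports Main "HOL-Library.Poly_Mapping"
begin

(* Quantum numbers [k] for a fixed value q = [2] *)
fun qn :: "'k::comm_ring_1 \<Rightarrow> nat \<Rightarrow> 'k" where
  "qn q 0 = 0"
| "qn q (Suc 0) = 1"
| "qn q (Suc (Suc k)) = q * qn q (Suc k) - qn q k"

(* h = 'n \<Rightarrow> 'k (free of finite rank, standard basis indexed by the finite type 'n),
   h* = 'n \<Rightarrow> 'k (dual basis), pairing <x, xi> *)
definition pair :: "('n::finite \<Rightarrow> 'k::comm_ring_1) \<Rightarrow> ('n \<Rightarrow> 'k) \<Rightarrow> 'k" where
  "pair x \<xi> = (\<Sum>i\<in>UNIV. x i * \<xi> i)"

(* realization data: (alpha_s^vee, alpha_t^vee, alpha_s, alpha_t) *)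
type_synonym ('n, 'k) rlz = "('n \<Rightarrow> 'k) \<times> ('n \<Rightarrow> 'k) \<times> ('n \<Rightarrow> 'k) \<times> ('n \<Rightarrow> 'k)"

(* letters: True = s, False = t *)
definition coroot :: "('n, 'k) rlz \<Rightarrow> bool \<Rightarrow> ('n \<Rightarrow> 'k)" where
  "coroot Rz b = (if b then fst Rz else fst (snd Rz))"
definition root :: "('n, 'k) rlz \<Rightarrow> bool \<Rightarrow> ('n \<Rightarrow> 'k)" where
  "root Rz b = (if b then fst (snd (snd Rz)) else snd (snd (snd Rz)))"

definition hact :: "('n::finite, 'k::comm_ring_1) rlz \<Rightarrow> bool \<Rightarrow> ('n \<Rightarrow> 'k) \<Rightarrow> ('n \<Rightarrow> 'k)" where
  "hact Rz b x = (\<lambda>i. x i - pair x (root Rz b) * coroot Rz b i)"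

definition hdact :: "('n::finite, 'k::comm_ring_1) rlz \<Rightarrow> bool \<Rightarrow> ('n \<Rightarrow> 'k) \<Rightarrow> ('n \<Rightarrow> 'k)" where
  "hdact Rz b \<xi> = (\<lambda>i. \<xi> i - pair (coroot Rz b) \<xi> * root Rz b i)"

fun hword :: "('n::finite, 'k::comm_ring_1) rlz \<Rightarrow> bool list \<Rightarrow> ('n \<Rightarrow> 'k) \<Rightarrow> ('n \<Rightarrow> 'k)" where
  "hword Rz [] = id"
| "hword Rz (b # w) = hact Rz b \<circ> hword Rz w"

(* W realised as the group of linear maps of h generated by s and t, with Coxeter length *)
definition Wgrp :: "('n::finite, 'k::comm_ring_1) rlz \<Rightarrow> (('n \<Rightarrow> 'k) \<Rightarrow> ('n \<Rightarrow> 'k)) set" where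
  "Wgrp Rz = range (hword Rz)"
definition wlen :: "('n::finite, 'k::comm_ring_1) rlz \<Rightarrow> (('n \<Rightarrow> 'k) \<Rightarrow> ('n \<Rightarrow> 'k)) \<Rightarrow> nat" where
  "wlen Rz g = (LEAST n. \<exists>w. length w = n \<and> hword Rz w = g)"

(* Standing hypotheses: balanced symmetric realization of the dihedral group with
   m_st = m (finite, m \<ge> 2), q = [2], Demazure surjectivity, local non-degeneracy,
   lesser invertibility. *)
definition dihedral_realization :: "('n::finite, 'k::comm_ring_1) rlz \<Rightarrow> 'k \<Rightarrow> nat \<Rightarrow> bool" where
  "dihedral_realization Rz q m \<longleftrightarrow>
     2 \<le> m \<and>
     pair (coroot Rz True) (root Rz True) = 2 \<and>
     pair (coroot Rz False) (root Rz False) = 2 \<and>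
     pair (coroot Rz True) (root Rz False) = - q \<and>
     pair (coroot Rz False) (root Rz True) = - q \<and>
     qn q m = 0 \<and> qn q (m - 1) = 1 \<and>
     hact Rz True \<circ> hact Rz True = id \<and> hact Rz False \<circ> hact Rz False = id \<and>
     (hact Rz True \<circ> hact Rz False) ^^ m = id \<and>
     (\<forall>u. surj (\<lambda>x. pair x (root Rz u)) \<and> surj (\<lambda>\<xi>. pair (coroot Rz u) \<xi>)) \<and>
     (4 - q ^ 2) dvd 1 \<and>
     (\<forall>k. 1 \<le> k \<and> k < m \<longrightarrow> qn q k dvd 1) \<and>
     hact Rz True \<noteq> id \<and> hact Rz False \<noteq> id \<and>
     (\<forall>j. 0 < j \<and> j < m \<longrightarrow> (hact Rz True \<circ> hact Rz False) ^^ j \<noteq> id)"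

(* R = Sym(h_dual) = polynomial ring over 'k in the dual basis variables x_i *)
type_synonym ('n, 'k) mpoly = "('n \<Rightarrow>\<^sub>0 nat) \<Rightarrow>\<^sub>0 'k"

definition mconst :: "'k::comm_ring_1 \<Rightarrow> ('n, 'k) mpoly" where
  "mconst c = Poly_Mapping.single 0 c"
definition mvar :: "'n \<Rightarrow> ('n, 'k::comm_ring_1) mpoly" where
  "mvar i = Poly_Mapping.single (Poly_Mapping.single i 1) 1"
definition lin :: "('n::finite \<Rightarrow> 'k::comm_ring_1) \<Rightarrow> ('n, 'k) mpoly" where
  "lin \<xi> = (\<Sum>i\<in>UNIV. mconst (\<xi> i) * mvar i)"
definition msubst :: "('n \<Rightarrow> ('n, 'k::comm_ring_1) mpoly) \<Rightarrow> ('n, 'k) mpoly \<Rightarrow> ('n, 'k) mpoly" where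
  "msubst \<sigma> p = (\<Sum>\<mu>\<in>Poly_Mapping.keys p.
      mconst (Poly_Mapping.lookup p \<mu>) * (\<Prod>i\<in>Poly_Mapping.keys \<mu>. \<sigma> i ^ Poly_Mapping.lookup \<mu> i))"
(* R is graded with h_dual in degree 2 *)
definition homog :: "('n::finite, 'k::comm_ring_1) mpoly \<Rightarrow> int \<Rightarrow> bool" where
  "homog p d \<longleftrightarrow> (\<forall>\<mu>\<in>Poly_Mapping.keys p. 2 * int (\<Sum>i\<in>UNIV. Poly_Mapping.lookup \<mu> i) = d)"

definition ract :: "('n::finite, 'k::comm_ring_1) rlz \<Rightarrow> bool \<Rightarrow> ('n, 'k) mpoly \<Rightarrow> ('n, 'k) mpoly" where
  "ract Rz b p = msubst (\<lambda>i. lin (hdact Rz b (\<lambda>j. if j = i then 1 else 0))) p"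

definition Rinv :: "('n::finite, 'k::comm_ring_1) rlz \<Rightarrow> bool set \<Rightarrow> ('n, 'k) mpoly set" where
  "Rinv Rz J = {p. \<forall>b\<in>J. ract Rz b p = p}"

definition pdiv :: "'a::comm_ring_1 \<Rightarrow> 'a \<Rightarrow> 'a" where
  "pdiv p d = (THE r. d * r = p)"

definition dem :: "('n::finite, 'k::comm_ring_1) rlz \<Rightarrow> bool \<Rightarrow> ('n, 'k) mpoly \<Rightarrow> ('n, 'k) mpoly" where
  "dem Rz b p = pdiv (p - ract Rz b p) (lin (root Rz b))"

fun dem_comp :: "('n::finite, 'k::comm_ring_1) rlz \<Rightarrow> bool list \<Rightarrow> ('n, 'k) mpoly \<Rightarrow> ('n, 'k) mpoly" where
  "dem_comp Rz [] = id"
| "dem_comp Rz (b # w) = dem Rz b \<circ> dem_comp Rz w"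

fun alt :: "bool \<Rightarrow> nat \<Rightarrow> bool list" where
  "alt b 0 = []"
| "alt b (Suc k) = b # alt (\<not> b) k"

definition dW :: "('n::finite, 'k::comm_ring_1) rlz \<Rightarrow> nat \<Rightarrow> ('n, 'k) mpoly \<Rightarrow> ('n, 'k) mpoly" where
  "dW Rz m = dem_comp Rz (alt True m)"
definition dsW :: "('n::finite, 'k::comm_ring_1) rlz \<Rightarrow> nat \<Rightarrow> ('n, 'k) mpoly \<Rightarrow> ('n, 'k) mpoly" where
  "dsW Rz m = dem_comp Rz (rev (alt False (m - 1)))"
definition dtW :: "('n::finite, 'k::comm_ring_1) rlz \<Rightarrow> nat \<Rightarrow> ('n, 'k) mpoly \<Rightarrow> ('n, 'k) mpoly" where
  "dtW Rz m = dem_comp Rz (rev (alt True (m - 1)))"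

(* x(xi) for a word x given rightmost letter first *)
fun hdword_r :: "('n::finite, 'k::comm_ring_1) rlz \<Rightarrow> bool list \<Rightarrow> ('n \<Rightarrow> 'k) \<Rightarrow> ('n \<Rightarrow> 'k)" where
  "hdword_r Rz [] \<xi> = \<xi>"
| "hdword_r Rz (b # w) \<xi> = hdword_r Rz w (hdact Rz b \<xi>)"

definition froot :: "('n::finite, 'k::comm_ring_1) rlz \<Rightarrow> bool \<Rightarrow> nat \<Rightarrow> ('n, 'k) mpoly" where
  "froot Rz u k = lin (hdword_r Rz (alt (\<not> u) k) (root Rz u))"

(* \<Lambda> = product of the positive roots *)
definition Lambda :: "('n::finite, 'k::comm_ring_1) rlz \<Rightarrow> nat \<Rightarrow> ('n, 'k) mpoly" where
  "Lambda Rz m = (if even m then (\<Prod>l<m div 2. froot Rz True l * froot Rz False l)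
                  else (\<Prod>l<m. froot Rz True l))"

definition free_basis :: "'a::comm_ring_1 set \<Rightarrow> 'a set \<Rightarrow> nat \<Rightarrow> (nat \<Rightarrow> 'a) \<Rightarrow> bool" where
  "free_basis A B r b \<longleftrightarrow> (\<forall>i<r. b i \<in> B) \<and>
     (\<forall>y\<in>B. \<exists>!a. (\<forall>i<r. a i \<in> A) \<and> (\<forall>i. r \<le> i \<longrightarrow> a i = 0) \<and> y = (\<Sum>i<r. a i * b i))"

definition dual_bases :: "'a::comm_ring_1 set \<Rightarrow> 'a set \<Rightarrow> ('a \<Rightarrow> 'a) \<Rightarrow> nat \<Rightarrow> (nat \<Rightarrow> 'a) \<Rightarrow> (nat \<Rightarrow> 'a) \<Rightarrow> bool" where
  "dual_bases A B tr r f g \<longleftrightarrow> free_basis A B r f \<and> free_basis A B r g \<and>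
     (\<forall>i<r. \<forall>j<r. tr (f i * g j) = (if i = j then 1 else 0))"

definition frob_ext :: "'a::comm_ring_1 set \<Rightarrow> 'a set \<Rightarrow> ('a \<Rightarrow> 'a) \<Rightarrow> bool" where
  "frob_ext A B tr \<longleftrightarrow> A \<subseteq> B \<and> (\<forall>y\<in>B. tr y \<in> A) \<and>
     (\<forall>a\<in>A. \<forall>y\<in>B. \<forall>y'\<in>B. tr (a * y + y') = a * tr y + tr y') \<and>
     (\<exists>r f g. dual_bases A B tr r f g)"

definition graded_frob_ext :: "('n::finite, 'k::comm_ring_1) mpoly set \<Rightarrow> ('n, 'k) mpoly set \<Rightarrow>
    (('n, 'k) mpoly \<Rightarrow> ('n, 'k) mpoly) \<Rightarrow> bool" where
  "graded_frob_ext A B tr \<longleftrightarrow> frob_ext A B tr \<and>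
     (\<exists>l. \<forall>y\<in>B. \<forall>d. homog y d \<longrightarrow> homog (tr y) (d - l)) \<and>
     (\<exists>r f g df dg. dual_bases A B tr r f g \<and> (\<forall>i<r. homog (f i) (df i) \<and> homog (g i) (dg i)))"

definition frob_square :: "('n::finite, 'k::comm_ring_1) mpoly set \<Rightarrow> ('n, 'k) mpoly set \<Rightarrow> ('n, 'k) mpoly set \<Rightarrow>
    ('n, 'k) mpoly set \<Rightarrow> (('n, 'k) mpoly \<Rightarrow> ('n, 'k) mpoly) \<Rightarrow> (('n, 'k) mpoly \<Rightarrow> ('n, 'k) mpoly) \<Rightarrow>
    (('n, 'k) mpoly \<Rightarrow> ('n, 'k) mpoly) \<Rightarrow> (('n, 'k) mpoly \<Rightarrow> ('n, 'k) mpoly) \<Rightarrow>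
    (('n, 'k) mpoly \<Rightarrow> ('n, 'k) mpoly) \<Rightarrow> bool" where
  "frob_square A Bs Bt B ts tt tsA ttA tA \<longleftrightarrow>
     graded_frob_ext Bs B ts \<and> graded_frob_ext Bt B tt \<and>
     graded_frob_ext A Bs tsA \<and> graded_frob_ext A Bt ttA \<and>
     (\<forall>y\<in>B. tsA (ts y) = tA y \<and> ttA (tt y) = tA y)"

definition free_graded :: "('n::finite, 'k::comm_ring_1) mpoly set \<Rightarrow> ('n, 'k) mpoly set \<Rightarrow> nat \<Rightarrow>
    (nat \<Rightarrow> ('n, 'k) mpoly) \<Rightarrow> (nat \<Rightarrow> int) \<Rightarrow> bool" where
  "free_graded A M r b d \<longleftrightarrow> free_basis A M r b \<and> (\<forall>i<r. homog (b i) (d i))"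

(* Laurent polynomials in v as coefficient functions int \<Rightarrow> int.
   graded rank of M(k) for basis degrees d_0..d_{r-1} of M *)
definition grk :: "nat \<Rightarrow> (nat \<Rightarrow> int) \<Rightarrow> int \<Rightarrow> int \<Rightarrow> int" where
  "grk r d k = (\<lambda>j. int (card {i. i < r \<and> d i - k = j}))"

(* [W] = v^{-m} \<Sum>_{w} v^{2 l(w)} *)
definition poincW :: "('n::finite, 'k::comm_ring_1) rlz \<Rightarrow> nat \<Rightarrow> int \<Rightarrow> int" where
  "poincW Rz m = (\<lambda>j. int (card {g \<in> Wgrp Rz. 2 * int (wlen Rz g) - int m = j}))"

definition mul_vvinv :: "(int \<Rightarrow> int) \<Rightarrow> int \<Rightarrow> int" where
  "mul_vvinv P = (\<lambda>j. P (j - 1) + P (j + 1))"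

(* Tensor product B \<otimes>_A C (A \<subseteq> B, C subrings of a commutative ring), as the free abelian
   group on B \<times> C modulo the bilinearity and balancing relations. Elements are
   represented by finite lists of simple tensors. *)
definition fsum :: "('a \<times> 'a) list \<Rightarrow> ('a \<times> 'a) \<Rightarrow>\<^sub>0 int" where
  "fsum xs = sum_list (map (\<lambda>x. Poly_Mapping.single x 1) xs)"

inductive_set trel :: "'a::comm_ring_1 set \<Rightarrow> 'a set \<Rightarrow> 'a set \<Rightarrow> (('a \<times> 'a) \<Rightarrow>\<^sub>0 int) set"
  for A B C where
  zero: "0 \<in> trel A B C"
| addl: "b \<in> B \<Longrightarrow> b' \<in> B \<Longrightarrow> c \<in> C \<Longrightarrow>
     fsum [(b + b', c)] - fsum [(b, c)] - fsum [(b', c)] \<in> trel A B C"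
| addr: "b \<in> B \<Longrightarrow> c \<in> C \<Longrightarrow> c' \<in> C \<Longrightarrow>
     fsum [(b, c + c')] - fsum [(b, c)] - fsum [(b, c')] \<in> trel A B C"
| bal: "a \<in> A \<Longrightarrow> b \<in> B \<Longrightarrow> c \<in> C \<Longrightarrow>
     fsum [(b * a, c)] - fsum [(b, a * c)] \<in> trel A B C"
| plus: "x \<in> trel A B C \<Longrightarrow> y \<in> trel A B C \<Longrightarrow> x + y \<in> trel A B C"
| neg: "x \<in> trel A B C \<Longrightarrow> - x \<in> trel A B C"

definition teq :: "'a::comm_ring_1 set \<Rightarrow> 'a set \<Rightarrow> 'a set \<Rightarrow> ('a \<times> 'a) list \<Rightarrow> ('a \<times> 'a) list \<Rightarrow> bool" where
  "teq A B C xs ys \<longleftrightarrow> set xs \<subseteq> B \<times> C \<and> set ys \<subseteq> B \<times> C \<and> fsum xs - fsum ys \<in> trel A B C"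

end

(* Let a = P s, b = P t be the fundamental weights in the span of the two simple roots (they exist
   because 4 - [2]^2 is invertible). The weight b is fixed by s and has an orbit X 0, ..., X (m-1)
   of size m, ordered so that the generators act on it like the reflections of a path of length m;
   consecutive elements differ by [j] times a simple root. Hence F(T) = prod (T - X j) has
   coefficients in R^W, and since a is a root of a monic quadratic polynomial over R^W[b], the
   monomials b^i a^j with i < m, j < 2 span R over R^W.

   Applying alternating Demazure operators coefficientwise to G(T) = F(T) / (T - X 0) strips one
   linear factor at a time, with factor [j]; so the trace of R^s over R^W sends the constant
   coefficient of G to the unit [m-1]! and all others to 0. By Horner's scheme the powers of b are
   then dual, up to this unit, to the coefficients of G. Both composite traces are R^W-linear and
   agree on the spanning monomials, which gives the braid relation. The formulas for the
   comultiplication elements do not depend on the dual bases and become evaluations of G at X 0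
   and X 1 for this choice, and the product of the X 0 - X j is [m-1]! times the product of the
   positive roots other than alpha_s. *)
theory Submission
  imports "HOL-Computational_Algebra.Polynomial" Defs
begin

section \<open>Evaluation of multivariate polynomials\<close>

text \<open>The ground ring is an arbitrary commutative ring, so no argument passes to a fraction
  field: cancellation is done only by simple roots, which Demazure surjectivity makes
  non-zero-divisors, and division only by 4 - [2]^2 and by [1], ..., [m-1].

  The obstacle is the target of the composite traces. Such a composite is visibly invariant only
  under the letter applied last; that its values lie in R^W follows once the two composites of
  length m on R, which end in different letters, are known to agree. Until then only R^W-linearity
  is available, so the two are compared on the monomials b^i a^j.

  The quadratic for a comes from the W-invariant norm form a^2 - [2] a b + b^2. In degree m it turns
  the traces of b^(m-j) a^j into a sequence with the recurrence of the quantum numbers and value [j]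
  [m-1]!. Read from the s-side, b^(m-1) a has trace [m-1]!; from the t-side it has trace [m-1]
  [m-1]!, and the balanced condition [m-1] = 1 closes the gap.\<close>

definition ring_hom_fun :: "('a::comm_ring_1 \<Rightarrow> 'b::comm_ring_1) \<Rightarrow> bool" where
  "ring_hom_fun \<phi> \<longleftrightarrow> \<phi> 1 = 1 \<and> (\<forall>a b. \<phi> (a + b) = \<phi> a + \<phi> b) \<and> (\<forall>a b. \<phi> (a * b) = \<phi> a * \<phi> b)"

context
  fixes \<phi> :: "'a::comm_ring_1 \<Rightarrow> 'b::comm_ring_1"
  assumes hom: "ring_hom_fun \<phi>"
begin

lemma rhom_1: "\<phi> 1 = 1" and rhom_add: "\<phi> (a + b) = \<phi> a + \<phi> b" and rhom_mult: "\<phi> (a * b) = \<phi> a * \<phi> b"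
  using hom by (auto simp: ring_hom_fun_def)

lemma rhom_0: "\<phi> 0 = 0"
  using rhom_add[of 0 0] by simp

lemma rhom_minus: "\<phi> (- a) = - \<phi> a"
  using rhom_add[of a "- a"] rhom_0 by (simp add: eq_neg_iff_add_eq_0 add.commute)

lemma rhom_diff: "\<phi> (a - b) = \<phi> a - \<phi> b"
  using rhom_add[of a "- b"] rhom_minus[of b] by simp

lemma rhom_sum: "\<phi> (\<Sum>i\<in>I. f i) = (\<Sum>i\<in>I. \<phi> (f i))"
  by (induction I rule: infinite_finite_induct) (auto simp: rhom_0 rhom_add)

lemma rhom_power: "\<phi> (a ^ n) = \<phi> a ^ n"
  by (induction n) (auto simp: rhom_1 rhom_mult)

end

text \<open>The product runs over all indices, not only over \<open>keys \<mu>\<close>, which makes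
  it multiplicative in \<open>\<mu>\<close> without bookkeeping of supports.\<close>

definition mono_eval :: "('n::finite \<Rightarrow> 'b::comm_ring_1) \<Rightarrow> ('n \<Rightarrow>\<^sub>0 nat) \<Rightarrow> 'b" where
  "mono_eval \<sigma> \<mu> = (\<Prod>i\<in>UNIV. \<sigma> i ^ Poly_Mapping.lookup \<mu> i)"

lemma mono_eval_keys: "(\<Prod>i\<in>Poly_Mapping.keys \<mu>. \<sigma> i ^ Poly_Mapping.lookup \<mu> i) = mono_eval \<sigma> \<mu>"
  unfolding mono_eval_def
  by (rule prod.mono_neutral_left) (auto simp: in_keys_iff)

lemma mono_eval_0 [simp]: "mono_eval \<sigma> 0 = 1"
  by (simp add: mono_eval_def)

lemma mono_eval_add: "mono_eval \<sigma> (\<mu> + \<nu>) = mono_eval \<sigma> \<mu> * mono_eval \<sigma> \<nu>"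
  by (simp add: mono_eval_def lookup_add power_add prod.distrib)

lemma mono_eval_single [simp]: "mono_eval \<sigma> (Poly_Mapping.single i n) = \<sigma> i ^ n"
proof -
  have "mono_eval \<sigma> (Poly_Mapping.single i n) = (\<Prod>j\<in>UNIV. if j = i then \<sigma> j ^ n else 1)"
    unfolding mono_eval_def by (rule prod.cong) (auto simp: lookup_single when_def)
  then show ?thesis by simp
qed

text \<open>The target ring is arbitrary because substitutions into polynomials over R are needed
  besides \<open>msubst\<close>.\<close>

definition meval :: "('k::comm_ring_1 \<Rightarrow> 'b::comm_ring_1) \<Rightarrow> ('n::finite \<Rightarrow> 'b) \<Rightarrow> ('n, 'k) mpoly \<Rightarrow> 'b" where
  "meval \<phi> \<sigma> p = (\<Sum>\<mu>\<in>Poly_Mapping.keys p. \<phi> (Poly_Mapping.lookup p \<mu>) * mono_eval \<sigma> \<mu>)"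

lemma msubst_eq_meval: "msubst \<sigma> p = meval mconst \<sigma> p"
  by (simp add: msubst_def meval_def mono_eval_keys)

lemma poly_mapping_as_sum: "(\<Sum>\<mu>\<in>Poly_Mapping.keys p. Poly_Mapping.single \<mu> (Poly_Mapping.lookup p \<mu>)) = p"
  by (rule poly_mapping_eqI) (auto simp: lookup_sum lookup_single when_def in_keys_iff)

context
  fixes \<phi> :: "'k::comm_ring_1 \<Rightarrow> 'b::comm_ring_1" and \<sigma> :: "'n::finite \<Rightarrow> 'b"
  assumes hom: "ring_hom_fun \<phi>"
begin

lemma meval_superset:
  assumes "finite K" "Poly_Mapping.keys p \<subseteq> K"
  shows "meval \<phi> \<sigma> p = (\<Sum>\<mu>\<in>K. \<phi> (Poly_Mapping.lookup p \<mu>) * mono_eval \<sigma> \<mu>)"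
  unfolding meval_def by (rule sum.mono_neutral_left) (use assms in \<open>auto simp: in_keys_iff rhom_0[OF hom]\<close>)

lemma meval_add: "meval \<phi> \<sigma> (p + q) = meval \<phi> \<sigma> p + meval \<phi> \<sigma> q"
proof -
  let ?K = "Poly_Mapping.keys p \<union> Poly_Mapping.keys q"
  have "meval \<phi> \<sigma> (p + q) = (\<Sum>\<mu>\<in>?K. \<phi> (Poly_Mapping.lookup (p + q) \<mu>) * mono_eval \<sigma> \<mu>)"
    by (rule meval_superset) (simp_all add: Poly_Mapping.keys_add)
  also have "\<dots> = meval \<phi> \<sigma> p + meval \<phi> \<sigma> q"
    by (subst (1 2) meval_superset[of ?K]) (auto simp: lookup_add rhom_add[OF hom] sum.distrib ring_distribs)
  finally show ?thesis .
qed

lemma meval_0 [simp]: "meval \<phi> \<sigma> 0 = 0"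
  by (simp add: meval_def)

lemma meval_sum: "meval \<phi> \<sigma> (\<Sum>i\<in>I. f i) = (\<Sum>i\<in>I. meval \<phi> \<sigma> (f i))"
  by (induction I rule: infinite_finite_induct) (auto simp: meval_add)

lemma meval_single: "meval \<phi> \<sigma> (Poly_Mapping.single \<mu> c) = \<phi> c * mono_eval \<sigma> \<mu>"
  by (cases "c = 0") (simp_all add: meval_def rhom_0[OF hom])

lemma meval_mult: "meval \<phi> \<sigma> (p * q) = meval \<phi> \<sigma> p * meval \<phi> \<sigma> q"
proof -
  have "meval \<phi> \<sigma> (p * q) = meval \<phi> \<sigma>
     ((\<Sum>\<mu>\<in>Poly_Mapping.keys p. Poly_Mapping.single \<mu> (Poly_Mapping.lookup p \<mu>)) *
      (\<Sum>\<mu>\<in>Poly_Mapping.keys q. Poly_Mapping.single \<mu> (Poly_Mapping.lookup q \<mu>)))"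
    by (simp add: poly_mapping_as_sum)
  also have "\<dots> = meval \<phi> \<sigma> p * meval \<phi> \<sigma> q"
    unfolding sum_product meval_sum mult_single meval_single mono_eval_add rhom_mult[OF hom]
    by (simp add: meval_def sum_product mult_ac)
  finally show ?thesis .
qed

lemma meval_mconst [simp]: "meval \<phi> \<sigma> (mconst c) = \<phi> c"
  by (simp add: mconst_def meval_single)

lemma meval_mvar [simp]: "meval \<phi> \<sigma> (mvar i) = \<sigma> i"
  by (simp add: mvar_def meval_single rhom_1[OF hom])

lemma ring_hom_meval: "ring_hom_fun (meval \<phi> \<sigma>)"
proof -
  have "meval \<phi> \<sigma> 1 = 1"
    using meval_mconst[of 1] by (simp add: mconst_def rhom_1[OF hom])
  then show ?thesis
    by (simp add: ring_hom_fun_def meval_add meval_mult)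
qed

lemma meval_lin: "meval \<phi> \<sigma> (lin \<xi>) = (\<Sum>i\<in>UNIV. \<phi> (\<xi> i) * \<sigma> i)"
  by (simp add: lin_def meval_sum meval_mult)

end

lemma ring_hom_mconst: "ring_hom_fun mconst"
  by (simp add: ring_hom_fun_def mconst_def single_add mult_single)

lemma ring_hom_pCons: "ring_hom_fun (\<lambda>c. [:c:])"
  by (simp add: ring_hom_fun_def one_pCons)

lemma ring_hom_comp: "ring_hom_fun f \<Longrightarrow> ring_hom_fun g \<Longrightarrow> ring_hom_fun (\<lambda>x. f (g x))"
  by (simp add: ring_hom_fun_def)

lemma ring_hom_poly: "ring_hom_fun (\<lambda>p. poly p x)"
  by (simp add: ring_hom_fun_def)

lemma single_eq_monom:
  fixes \<mu> :: "'n::finite \<Rightarrow>\<^sub>0 nat" and c :: "'k::comm_ring_1"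
  shows "Poly_Mapping.single \<mu> c = mconst c * mono_eval mvar \<mu>"
proof -
  have "mvar i ^ n = (Poly_Mapping.single (Poly_Mapping.single i n) 1 :: ('n, 'k) mpoly)" for i n
    by (induction n) (auto simp: mvar_def mult_single single_add[symmetric])
  moreover have "(\<Prod>i\<in>I. Poly_Mapping.single (f i) 1) = (Poly_Mapping.single (\<Sum>i\<in>I. f i) 1 :: ('n, 'k) mpoly)"
    for I and f :: "'n \<Rightarrow> _"
    by (induction I rule: infinite_finite_induct) (auto simp: mult_single)
  ultimately have "mono_eval mvar \<mu> = (Poly_Mapping.single (\<Sum>i\<in>UNIV. Poly_Mapping.single i (Poly_Mapping.lookup \<mu> i)) 1 :: ('n, 'k) mpoly)"
    by (simp add: mono_eval_def)
  moreover have "(\<Sum>i\<in>UNIV. Poly_Mapping.single i (Poly_Mapping.lookup \<mu> i)) = \<mu>"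
    by (rule poly_mapping_eqI) (auto simp: lookup_sum lookup_single when_def)
  ultimately show ?thesis
    by (simp add: mconst_def mult_single)
qed

lemma meval_id: "meval mconst mvar p = p"
proof -
  have "meval mconst mvar p = (\<Sum>\<mu>\<in>Poly_Mapping.keys p. Poly_Mapping.single \<mu> (Poly_Mapping.lookup p \<mu>))"
    by (simp add: meval_def single_eq_monom)
  then show ?thesis by (simp add: poly_mapping_as_sum)
qed

text \<open>The inductive step multiplies by one variable only, which suits properties such as
  divisibility or membership in a span that are not visibly stable under products.\<close>

lemma mpoly_induct [case_names const add var]:
  fixes p :: "('n::finite, 'k::comm_ring_1) mpoly"
  assumes const: "\<And>c. P (mconst c)"
    and add: "\<And>p q. P p \<Longrightarrow> P q \<Longrightarrow> P (p + q)"
    and var: "\<And>i p. P p \<Longrightarrow> P (mvar i * p)"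
  shows "P p"
proof -
  have pow: "P (mvar i ^ n * p)" if "P p" for i n p
    using that by (induction n) (auto simp: var mult.assoc)
  have prod: "finite I \<Longrightarrow> P ((\<Prod>i\<in>I. mvar i ^ f i) * mconst c)" for I c and f :: "'n \<Rightarrow> nat"
    by (induction I rule: finite_induct) (auto simp: const pow mult.assoc)
  have mono: "P (mconst c * mono_eval mvar \<mu>)" for c \<mu>
    using prod[of UNIV] by (simp add: mono_eval_def mult.commute)
  have "finite K \<Longrightarrow> P (\<Sum>\<mu>\<in>K. mconst (f \<mu>) * mono_eval mvar \<mu>)" for K f
  proof (induction K rule: finite_induct)
    case empty
    then show ?case using const[of 0] by (simp add: mconst_def)
  qed (auto simp: add mono)
  then have "P (meval mconst mvar p)"
    by (simp add: meval_def)
  then show ?thesis by (simp add: meval_id)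
qed

lemma ring_hom_eqI:
  fixes f g :: "('n::finite, 'k::comm_ring_1) mpoly \<Rightarrow> 'b::comm_ring_1"
  assumes "ring_hom_fun f" "ring_hom_fun g"
    and "\<And>c. f (mconst c) = g (mconst c)" "\<And>i. f (mvar i) = g (mvar i)"
  shows "f p = g p"
  by (induction p rule: mpoly_induct) (simp_all add: assms rhom_add rhom_mult)

section \<open>Homogeneous polynomials\<close>

lemma homog_0 [simp]: "homog 0 d"
  by (simp add: homog_def)

lemma homog_add: "homog p d \<Longrightarrow> homog q d \<Longrightarrow> homog (p + q) d"
  using Poly_Mapping.keys_add[of p q] unfolding homog_def by blast

lemma homog_minus: "homog p d \<Longrightarrow> homog (- p) d"
  unfolding homog_def by simp

lemma homog_diff: "homog p d \<Longrightarrow> homog q d \<Longrightarrow> homog (p - q) d"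
  using homog_add[of p d "- q"] homog_minus[of q d] by simp

lemma homog_sum: "(\<And>i. i \<in> I \<Longrightarrow> homog (f i) d) \<Longrightarrow> homog (\<Sum>i\<in>I. f i) d"
  by (induction I rule: infinite_finite_induct) (auto simp: homog_add)

lemma homog_mult:
  assumes "homog p d" "homog q e"
  shows "homog (p * q) (d + e)"
  unfolding homog_def
proof
  fix \<mu> assume "\<mu> \<in> Poly_Mapping.keys (p * q)"
  then obtain a b where ab: "a \<in> Poly_Mapping.keys p" "b \<in> Poly_Mapping.keys q" "\<mu> = a + b"
    using keys_mult[of p q] by auto
  have "2 * int (\<Sum>i\<in>UNIV. Poly_Mapping.lookup a i) = d" "2 * int (\<Sum>i\<in>UNIV. Poly_Mapping.lookup b i) = e"
    using assms ab unfolding homog_def by blast+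
  then show "2 * int (\<Sum>i\<in>UNIV. Poly_Mapping.lookup \<mu> i) = d + e"
    by (simp add: ab(3) lookup_add sum.distrib)
qed

lemma homog_mconst: "homog (mconst c) 0"
  by (simp add: homog_def mconst_def)

lemma homog_1: "homog 1 0"
  by (simp add: homog_def)

lemma homog_power: "homog p d \<Longrightarrow> homog (p ^ n) (int n * d)"
proof (induction n)
  case (Suc n)
  then show ?case using homog_mult[of p d "p ^ n" "int n * d"] by (simp add: algebra_simps)
qed (simp add: homog_1)

lemma homog_mvar: "homog (mvar i) 2"
proof -
  have "(\<Sum>j\<in>UNIV. Poly_Mapping.lookup (Poly_Mapping.single i (Suc 0)) j) = (\<Sum>j\<in>UNIV. if j = i then Suc 0 else 0)"
    by (rule sum.cong) (auto simp: lookup_single when_def)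
  then show ?thesis
    by (simp add: homog_def mvar_def)
qed

lemma homog_lin: "homog (lin \<xi>) 2"
  unfolding lin_def using homog_mult[OF homog_mconst homog_mvar] by (intro homog_sum) simp

lemma homog_as_sum:
  fixes p :: "('n::finite, 'k::comm_ring_1) mpoly"
  shows "p = (\<Sum>\<mu>\<in>Poly_Mapping.keys p. mconst (Poly_Mapping.lookup p \<mu>) * mono_eval mvar \<mu>)"
  using meval_id[of p] by (simp add: meval_def)

section \<open>Linear forms\<close>

lemma lin_add: "lin (\<lambda>i. f i + g i) = lin f + lin g"
  by (simp add: lin_def mconst_def single_add ring_distribs sum.distrib)

lemma lin_scale: "lin (\<lambda>i. c * f i) = mconst c * lin f"
  by (simp add: lin_def rhom_mult[OF ring_hom_mconst] sum_distrib_left mult.assoc)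

lemma lin_minus: "lin (\<lambda>i. - f i) = - lin f"
  by (simp add: lin_def rhom_minus[OF ring_hom_mconst] sum_negf)

lemma lin_diff: "lin (\<lambda>i. f i - g i) = lin f - lin g"
  using lin_add[of f "\<lambda>i. - g i"] by (simp add: lin_minus)

lemma lin_unit: "lin (\<lambda>j. if j = i then 1 else 0) = mvar i"
proof -
  have "lin (\<lambda>j. if j = i then 1 else 0) = (\<Sum>j\<in>UNIV. if j = i then mvar j else 0)"
    unfolding lin_def by (rule sum.cong) (auto simp: mconst_def)
  then show ?thesis by simp
qed

text \<open>Translating by a vector on which the form takes the value \<open>1\<close> turns it into a monic
  polynomial in the translation parameter.\<close>
lemma lin_nonzero_divisor:
  fixes \<xi> :: "'n::finite \<Rightarrow> 'k::comm_ring_1"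
  assumes x: "pair x \<xi> = 1" and p: "lin \<xi> * p = 0"
  shows "p = 0"
proof -
  \<comment> \<open>\<open>\<Phi>\<close> replaces each variable x_i by x_i + \<open>x i\<close> T,
    where T is the new polynomial variable.\<close>
  define \<Phi> where "\<Phi> = meval (\<lambda>c. [:mconst c:]) (\<lambda>i. [:mvar i, mconst (x i):]) "
  have hc: "ring_hom_fun (\<lambda>c. [:mconst c:] :: ('n, 'k) mpoly poly)"
    using ring_hom_comp[OF ring_hom_pCons ring_hom_mconst] .
  then have h: "ring_hom_fun \<Phi>"
    unfolding \<Phi>_def by (rule ring_hom_meval)
  have "mconst (pair x \<xi>) = (\<Sum>i\<in>UNIV. mconst (\<xi> i) * mconst (x i) :: ('n, 'k) mpoly)"
    by (simp add: pair_def rhom_sum[OF ring_hom_mconst] rhom_mult[OF ring_hom_mconst] mult.commute)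
  then have "(\<Sum>i\<in>UNIV. mconst (\<xi> i) * mconst (x i) :: ('n, 'k) mpoly) = 1"
    by (simp add: x mconst_def)
  moreover have "(\<Sum>i\<in>I. [:f i, g i:]) = [:\<Sum>i\<in>I. f i, \<Sum>i\<in>I. g i:]" for I and f g :: "'n \<Rightarrow> ('n, 'k) mpoly"
    by (induction I rule: infinite_finite_induct) auto
  ultimately have lin: "\<Phi> (lin \<xi>) = [:lin \<xi>, 1:]"
    unfolding \<Phi>_def meval_lin[OF hc] by (simp add: lin_def mult.commute)
  have "[:lin \<xi>, 1:] * \<Phi> p = 0"
    using p rhom_mult[OF h, of "lin \<xi>" p] by (simp add: lin rhom_0[OF h])
  \<comment> \<open>The factor is monic, so the top coefficient of the product is the leading
    coefficient of \<open>\<Phi> p\<close>.\<close>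
  then have "\<Phi> p = 0"
    using coeff_mult_degree_sum[of "[:lin \<xi>, 1:]" "\<Phi> p"] by simp
  \<comment> \<open>Setting the translation parameter to 0 recovers \<open>p\<close>.\<close>
  moreover have "poly (\<Phi> p) 0 = meval mconst mvar p"
    by (rule ring_hom_eqI[OF ring_hom_comp[OF ring_hom_poly h] ring_hom_meval[OF ring_hom_mconst]])
      (simp_all add: \<Phi>_def hc ring_hom_mconst)
  ultimately show ?thesis
    by (simp add: meval_id)
qed

lemma pdiv_eqI:
  assumes "\<And>p. d * p = 0 \<Longrightarrow> p = 0" and "d * r = p"
  shows "pdiv p d = r"
  unfolding pdiv_def
proof (rule the_equality)
  fix r' assume "d * r' = p"
  then have "d * (r' - r) = 0"
    using assms(2) by (simp add: algebra_simps)
  then have "r' - r = 0" by (rule assms(1))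
  then show "r' = r" by simp
qed (rule assms(2))

section \<open>Reflections and Demazure operators\<close>

lemma pair_add: "pair x (\<lambda>i. f i + g i) = pair x f + pair x g"
  by (simp add: pair_def sum.distrib ring_distribs)

lemma pair_scale: "pair x (\<lambda>i. c * f i) = c * pair x f"
  by (simp add: pair_def sum_distrib_left mult_ac)

lemma pair_unit: "pair x (\<lambda>j. if j = i then 1 else 0) = x i"
proof -
  have "pair x (\<lambda>j. if j = i then 1 else 0) = (\<Sum>j\<in>UNIV. if j = i then x j else 0)"
    unfolding pair_def by (rule sum.cong) auto
  then show ?thesis by simp
qed

lemma ring_hom_ract: "ring_hom_fun (ract Rz u)"
  unfolding ract_def msubst_eq_meval by (rule ring_hom_meval[OF ring_hom_mconst])

lemmas ract_1 [simp] = rhom_1[OF ring_hom_ract]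
  and ract_0 [simp] = rhom_0[OF ring_hom_ract]
  and ract_add = rhom_add[OF ring_hom_ract]
  and ract_mult = rhom_mult[OF ring_hom_ract]
  and ract_minus = rhom_minus[OF ring_hom_ract]
  and ract_diff = rhom_diff[OF ring_hom_ract]
  and ract_power = rhom_power[OF ring_hom_ract]
  and ract_sum = rhom_sum[OF ring_hom_ract]

lemmas mconst_mult = rhom_mult[OF ring_hom_mconst]
  and mconst_minus = rhom_minus[OF ring_hom_mconst]
  and mconst_diff = rhom_diff[OF ring_hom_mconst]
  and mconst_sum = rhom_sum[OF ring_hom_mconst]
  and mconst_0 [simp] = rhom_0[OF ring_hom_mconst]
  and mconst_1 [simp] = rhom_1[OF ring_hom_mconst]

lemma mconst_numeral [simp]: "mconst (numeral n) = numeral n"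
  by (simp add: mconst_def)

lemma ract_mconst [simp]: "ract Rz u (mconst c) = mconst c"
  unfolding ract_def msubst_eq_meval by (rule meval_mconst[OF ring_hom_mconst])

lemma lin_hdact: "lin (hdact Rz u \<xi>) = lin \<xi> - mconst (pair (coroot Rz u) \<xi>) * lin (root Rz u)"
  unfolding hdact_def lin_diff lin_scale ..

lemma ract_mvar: "ract Rz u (mvar i) = mvar i - mconst (coroot Rz u i) * lin (root Rz u)"
  unfolding ract_def msubst_eq_meval
  by (simp add: meval_mvar[OF ring_hom_mconst] lin_hdact lin_unit pair_unit)

lemma ract_lin: "ract Rz u (lin \<xi>) = lin (hdact Rz u \<xi>)"
proof -
  have "ract Rz u (lin \<xi>) = (\<Sum>i\<in>UNIV. mconst (\<xi> i) * (mvar i - mconst (coroot Rz u i) * lin (root Rz u)))"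
    by (simp add: lin_def[of \<xi>] ract_sum ract_mult ract_mvar)
  also have "\<dots> = lin \<xi> - (\<Sum>i\<in>UNIV. mconst (coroot Rz u i * \<xi> i)) * lin (root Rz u)"
    by (simp add: lin_def[of \<xi>] right_diff_distrib sum_subtractf sum_distrib_left sum_distrib_right mconst_mult mult_ac)
  finally show ?thesis
    by (simp add: lin_hdact pair_def mconst_sum)
qed

lemma Rinv_iff: "f \<in> Rinv Rz J \<longleftrightarrow> (\<forall>u\<in>J. ract Rz u f = f)"
  by (simp add: Rinv_def)

definition subring_set :: "'a::comm_ring_1 set \<Rightarrow> bool" where
  "subring_set A \<longleftrightarrow> 1 \<in> A \<and> (\<forall>a\<in>A. \<forall>b\<in>A. a - b \<in> A) \<and> (\<forall>a\<in>A. \<forall>b\<in>A. a * b \<in> A)"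

context
  fixes A :: "'a::comm_ring_1 set"
  assumes A: "subring_set A"
begin

lemma subring_1: "1 \<in> A" and subring_diff: "a \<in> A \<Longrightarrow> b \<in> A \<Longrightarrow> a - b \<in> A"
  and subring_mult: "a \<in> A \<Longrightarrow> b \<in> A \<Longrightarrow> a * b \<in> A"
  using A by (auto simp: subring_set_def)

lemma subring_0: "0 \<in> A"
  using subring_diff[OF subring_1 subring_1] by simp

lemma subring_minus: "a \<in> A \<Longrightarrow> - a \<in> A"
  using subring_diff[OF subring_0, of a] by simp

lemma subring_add: "a \<in> A \<Longrightarrow> b \<in> A \<Longrightarrow> a + b \<in> A"
  using subring_diff[of a "- b"] subring_minus[of b] by simp

lemma subring_sum: "(\<And>i. i \<in> I \<Longrightarrow> f i \<in> A) \<Longrightarrow> (\<Sum>i\<in>I. f i) \<in> A"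
  by (induction I rule: infinite_finite_induct) (auto simp: subring_0 subring_add)

lemma subring_power: "a \<in> A \<Longrightarrow> a ^ n \<in> A"
  by (induction n) (auto simp: subring_1 subring_mult)

end

lemma subring_UNIV: "subring_set UNIV"
  by (simp add: subring_set_def)

lemma subring_Rinv: "subring_set (Rinv Rz J)"
  by (simp add: subring_set_def Rinv_iff ract_diff ract_mult)

lemma mconst_in_Rinv: "mconst c \<in> Rinv Rz J"
  by (simp add: Rinv_iff)

locale dihedral =
  fixes Rz :: "('n::finite, 'k::comm_ring_1) rlz" and q :: 'k and m :: nat
  assumes realization: "dihedral_realization Rz q m"
begin

abbreviation S :: "bool \<Rightarrow> ('n, 'k) mpoly \<Rightarrow> ('n, 'k) mpoly" where "S u \<equiv> ract Rz u"
abbreviation D :: "bool \<Rightarrow> ('n, 'k) mpoly \<Rightarrow> ('n, 'k) mpoly" where "D u \<equiv> dem Rz u"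
abbreviation \<alpha> :: "bool \<Rightarrow> ('n, 'k) mpoly" where "\<alpha> u \<equiv> lin (root Rz u)"
abbreviation RW :: "('n, 'k) mpoly set" where "RW \<equiv> Rinv Rz {True, False}"
abbreviation Ru :: "bool \<Rightarrow> ('n, 'k) mpoly set" where "Ru u \<equiv> Rinv Rz {u}"

lemma m_ge_2: "2 \<le> m"
  using realization by (simp add: dihedral_realization_def)

lemma pair_coroot_root_self: "pair (coroot Rz u) (root Rz u) = 2"
  using realization by (cases u) (simp_all add: dihedral_realization_def)

lemma pair_coroot_root_other: "pair (coroot Rz u) (root Rz (\<not> u)) = - q"
  "pair (coroot Rz (\<not> u)) (root Rz u) = - q"
  using realization by (cases u; simp add: dihedral_realization_def)+

lemma qn_m: "qn q m = 0" and qn_m_minus_1: "qn q (m - 1) = 1"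
  using realization by (simp_all add: dihedral_realization_def)

lemma qn_unit: "1 \<le> k \<Longrightarrow> k < m \<Longrightarrow> qn q k dvd 1"
  using realization by (simp add: dihedral_realization_def)

lemma alpha_nonzero_divisor:
  assumes "\<alpha> u * f = 0" shows "f = 0"
proof -
  have "surj (\<lambda>x. pair x (root Rz u))"
    using realization by (simp add: dihedral_realization_def)
  then obtain x where "pair x (root Rz u) = 1"
    by (metis surjD)
  then show ?thesis
    using lin_nonzero_divisor assms by blast
qed

lemma alpha_cancel: "\<alpha> u * f = \<alpha> u * g \<Longrightarrow> f = g"
  using alpha_nonzero_divisor[of u "f - g"] by (simp add: right_diff_distrib)

lemma S_alpha_self: "S u (\<alpha> u) = - \<alpha> u"
  by (simp add: ract_lin lin_hdact pair_coroot_root_self)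

lemma S_S: "S u (S u f) = f"
proof (rule ring_hom_eqI[where g = "\<lambda>x. x"])
  show "ring_hom_fun (\<lambda>x. S u (S u x))"
    by (rule ring_hom_comp[OF ring_hom_ract ring_hom_ract])
  show "S u (S u (mvar i)) = mvar i" for i
    by (simp add: ract_mvar ract_diff ract_mult S_alpha_self)
qed (simp_all add: ring_hom_fun_def)

text \<open>Divisibility passes to sums and, by the twisted Leibniz identity in the
  \<open>var\<close> case, to products with a variable. Cancellation of \<open>\<alpha> u\<close>
  then makes the quotient unique, so the description inside \<open>pdiv\<close> denotes it.\<close>

lemma alpha_D: "\<alpha> u * D u f = f - S u f"
proof -
  have "\<exists>r. \<alpha> u * r = f - S u f"
  proof (induction f rule: mpoly_induct)
    case (const c)
    show ?case by (rule exI[of _ 0]) simp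
  next
    case (add f g)
    then obtain r r' where "\<alpha> u * r = f - S u f" "\<alpha> u * r' = g - S u g" by blast
    then have "\<alpha> u * (r + r') = f + g - S u (f + g)"
      by (simp add: ract_add distrib_left)
    then show ?case ..
  next
    case (var i f)
    then obtain r where r: "\<alpha> u * r = f - S u f" by blast
    have "mvar i * f - S u (mvar i * f) =
        mvar i * (f - S u f) + mconst (coroot Rz u i) * \<alpha> u * S u f"
      by (simp add: ract_mult ract_mvar algebra_simps)
    also have "\<dots> = \<alpha> u * (mvar i * r + mconst (coroot Rz u i) * S u f)"
      unfolding r[symmetric] by (simp add: algebra_simps)
    finally show ?case by metis
  qed
  then obtain r where r: "\<alpha> u * r = f - S u f" by blast
  then have "D u f = r"
    unfolding dem_def by (auto intro: pdiv_eqI dest: alpha_nonzero_divisor)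
  then show ?thesis using r by simp
qed

lemma D_eqI: "\<alpha> u * r = f - S u f \<Longrightarrow> D u f = r"
  using alpha_cancel alpha_D by metis

lemma D_add: "D u (f + g) = D u f + D u g"
  by (rule D_eqI) (simp add: ring_distribs alpha_D ract_add)

lemma D_mult: "D u (f * g) = D u f * g + S u f * D u g"
proof (rule D_eqI)
  have "\<alpha> u * (D u f * g + S u f * D u g) = (\<alpha> u * D u f) * g + S u f * (\<alpha> u * D u g)"
    by (simp add: algebra_simps)
  then show "\<alpha> u * (D u f * g + S u f * D u g) = f * g - S u (f * g)"
    unfolding alpha_D ract_mult by (simp add: left_diff_distrib right_diff_distrib)
qed

lemma D_inv: "f \<in> Ru u \<Longrightarrow> D u f = 0"
  by (rule D_eqI) (simp add: Rinv_iff)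

lemma D_0 [simp]: "D u 0 = 0"
  by (rule D_inv) (simp add: Rinv_iff)

lemma D_linear: "a \<in> Ru u \<Longrightarrow> D u (a * f) = a * D u f"
  by (simp add: D_mult D_inv) (simp add: Rinv_iff)

lemma D_sum: "D u (\<Sum>i\<in>I. f i) = (\<Sum>i\<in>I. D u (f i))"
  by (induction I rule: infinite_finite_induct) (auto simp: D_add)

text \<open>\<open>S u\<close> negates both \<open>\<alpha> u\<close> and \<open>f - S u f\<close>,
  hence fixes their quotient.\<close>

lemma D_in_Ru: "D u f \<in> Ru u"
proof -
  have "- (\<alpha> u * S u (D u f)) = S u (f - S u f)"
    using arg_cong[OF alpha_D[of u f], of "S u"] by (simp add: ract_mult S_alpha_self)
  then have "\<alpha> u * S u (D u f) = \<alpha> u * D u f"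
    unfolding alpha_D by (metis S_S minus_diff_eq minus_minus ract_diff)
  then show ?thesis
    using alpha_cancel by (simp add: Rinv_iff)
qed

lemma D_lin: "D u (lin \<xi>) = mconst (pair (coroot Rz u) \<xi>)"
  by (rule D_eqI) (simp add: ract_lin lin_hdact mult.commute)

lemma homog_D:
  assumes "homog f d" shows "homog (D u f) (d - 2)"
proof -
  \<comment> \<open>The Leibniz rule for \<open>D u\<close> mixes \<open>f\<close>,
    \<open>S u f\<close> and \<open>D u f\<close>, so the degrees of all three are carried
    along.\<close>
  define good where "good f d \<longleftrightarrow> homog f d \<and> homog (S u f) d \<and> homog (D u f) (d - 2)" for f d
  have good_1: "good 1 0"
    using D_inv[OF subring_1[OF subring_Rinv], of u] by (simp add: good_def homog_1)
  have good_mult: "good (f * g) (d + e)" if "good f d" "good g e" for f g d e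
    using that homog_mult[of f d g e] homog_mult[of "S u f" d "S u g" e]
      homog_mult[of "D u f" "d - 2" g e] homog_mult[of "S u f" d "D u g" "e - 2"]
    by (auto simp: good_def ract_mult D_mult algebra_simps intro: homog_add)
  have good_mvar: "good (mvar i) 2" for i
    unfolding good_def
    by (simp add: lin_unit[symmetric] ract_lin homog_lin D_lin homog_mconst)
  have good_power: "good (mvar i ^ n) (2 * int n)" for i n
  proof (induction n)
    case (Suc n)
    then show ?case
      using good_mult[OF good_mvar Suc, of i] by (simp add: algebra_simps)
  qed (simp add: good_1)
  have "finite I \<Longrightarrow> good (\<Prod>i\<in>I. mvar i ^ k i) (2 * int (\<Sum>i\<in>I. k i))" for I and k :: "'n \<Rightarrow> nat"
  proof (induction I rule: finite_induct)
    case (insert i I)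
    then show ?case
      using good_mult[OF good_power insert.IH, of i "k i"] by (simp add: algebra_simps)
  qed (simp add: good_1)
  then have mono: "good (mono_eval mvar \<mu>) (2 * int (\<Sum>i\<in>UNIV. Poly_Mapping.lookup \<mu> i))" for \<mu>
    by (simp add: mono_eval_def)
  have "homog (D u (\<Sum>\<mu>\<in>Poly_Mapping.keys f. mconst (Poly_Mapping.lookup f \<mu>) * mono_eval mvar \<mu>)) (d - 2)"
    unfolding D_sum D_linear[OF mconst_in_Rinv]
  proof (rule homog_sum)
    fix \<mu> assume "\<mu> \<in> Poly_Mapping.keys f"
    then have "2 * int (\<Sum>i\<in>UNIV. Poly_Mapping.lookup \<mu> i) = d"
      using assms by (simp add: homog_def)
    then have "homog (D u (mono_eval mvar \<mu>)) (d - 2)"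
      using mono[of \<mu>] by (simp add: good_def)
    then show "homog (mconst (Poly_Mapping.lookup f \<mu>) * D u (mono_eval mvar \<mu>)) (d - 2)"
      using homog_mult[OF homog_mconst] by fastforce
  qed
  then show ?thesis
    using homog_as_sum[of f] by simp
qed

section \<open>Fundamental weights\<close>

text \<open>4 - q^2 is the determinant of the Cartan matrix of s and t.\<close>

definition cartan_inv :: 'k where
  "cartan_inv = (SOME d. (4 - q ^ 2) * d = 1)"

text \<open>A row of the inverse Cartan matrix: the combination of simple roots that is 1 on the
  coroot of \<open>u\<close> and 0 on the other coroot.\<close>

definition weight :: "bool \<Rightarrow> 'n \<Rightarrow> 'k" where
  "weight u = (\<lambda>i. cartan_inv * (2 * root Rz u i + q * root Rz (\<not> u) i))"

abbreviation P :: "bool \<Rightarrow> ('n, 'k) mpoly" where "P u \<equiv> lin (weight u)"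

lemma cartan_inv: "(4 - q ^ 2) * cartan_inv = 1"
proof -
  have "(4 - q ^ 2) dvd 1"
    using realization by (simp add: dihedral_realization_def)
  then have "\<exists>d. (4 - q ^ 2) * d = 1" by (metis dvdE)
  then show ?thesis unfolding cartan_inv_def by (rule someI_ex)
qed

lemma pair_weight_self: "pair (coroot Rz u) (weight u) = 1"
proof -
  have "pair (coroot Rz u) (weight u) = (4 - q ^ 2) * cartan_inv"
    unfolding weight_def pair_scale pair_add pair_coroot_root_self pair_coroot_root_other
    by (simp add: algebra_simps power2_eq_square)
  then show ?thesis by (simp add: cartan_inv)
qed

lemma pair_weight_other: "pair (coroot Rz (\<not> u)) (weight u) = 0"
  unfolding weight_def pair_scale pair_add pair_coroot_root_self pair_coroot_root_other
  by (simp add: algebra_simps)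

lemma S_P_self: "S u (P u) = P u - \<alpha> u"
  by (simp add: ract_lin lin_hdact pair_weight_self)

lemma S_P_other: "S (\<not> u) (P u) = P u" "S u (P (\<not> u)) = P (\<not> u)"
  using pair_weight_other[of "\<not> u"] by (simp_all add: ract_lin lin_hdact pair_weight_other)

lemma alpha_eq: "\<alpha> u = 2 * P u - mconst q * P (\<not> u)"
proof -
  have "lin (weight u) = mconst cartan_inv * (2 * \<alpha> u + mconst q * \<alpha> (\<not> u))" for u
    by (simp add: weight_def lin_scale lin_add)
  then have "2 * P u - mconst q * P (\<not> u) = mconst ((4 - q ^ 2) * cartan_inv) * \<alpha> u"
    by (simp add: mconst_diff mconst_mult power2_eq_square algebra_simps)
  then show ?thesis by (simp add: cartan_inv)
qed

lemma P_other_in_Ru: "P (\<not> u) \<in> Ru u"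
  by (simp add: Rinv_iff S_P_other)

lemma D_P_self: "D u (P u) = 1"
  by (simp add: D_lin pair_weight_self)

lemma RW_subset_Ru: "RW \<subseteq> Ru u"
  by (cases u) (auto simp: Rinv_iff)

lemma RW_iff: "f \<in> RW \<longleftrightarrow> S u f = f \<and> S (\<not> u) f = f"
  by (cases u) (auto simp: Rinv_iff)

text \<open>Removing the two weight components leaves a linear form that vanishes on both coroots
  and is therefore fixed by W. Hence the two weights generate R over R^W.\<close>

lemma mvar_decomposition:
  "mvar i - mconst (coroot Rz True i) * P True - mconst (coroot Rz False i) * P False \<in> RW"
  using S_P_self[of True] S_P_self[of False] S_P_other[of True] S_P_other[of False]
  by (simp add: Rinv_iff ract_diff ract_mult ract_mvar) (simp add: algebra_simps)

text \<open>\<open>S u\<close> exchanges \<open>P u\<close> and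
  \<open>mconst q * P (\<not> u) - P u\<close>, and the form is the square of the
  \<open>u\<close>-fixed weight \<open>P (\<not> u)\<close> minus their product. It is symmetric in
  the two weights, so the other reflection fixes it as well.\<close>

lemma norm_form_in_RW:
  "P u ^ 2 - mconst q * P u * P (\<not> u) + P (\<not> u) ^ 2 \<in> RW"
proof -
  have "S v (P v ^ 2 - mconst q * P v * P (\<not> v) + P (\<not> v) ^ 2) = P v ^ 2 - mconst q * P v * P (\<not> v) + P (\<not> v) ^ 2" for v
    by (simp add: ract_add ract_diff ract_mult ract_power S_P_self S_P_other alpha_eq[of v] algebra_simps power2_eq_square)
  from this[of u] this[of "\<not> u"] show ?thesis
    unfolding RW_iff[of _ u] by (simp add: algebra_simps)
qed

end

section \<open>Dual bases of Frobenius extensions\<close>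

text \<open>The common setting of the extensions R^u in R, R^W in R^u and R^W in R. No duality is
  assumed, since it is derived from explicit families.\<close>

locale trace_ext =
  fixes A B :: "'a::comm_ring_1 set" and tr :: "'a \<Rightarrow> 'a"
  assumes subring_A: "subring_set A" and subring_B: "subring_set B" and A_subset_B: "A \<subseteq> B"
    and tr_in: "y \<in> B \<Longrightarrow> tr y \<in> A"
    and tr_linear: "a \<in> A \<Longrightarrow> y \<in> B \<Longrightarrow> y' \<in> B \<Longrightarrow> tr (a * y + y') = a * tr y + tr y'"
begin

lemma tr_0 [simp]: "tr 0 = 0"
  using tr_linear[of 1 0 0] subring_1[OF subring_A] subring_0[OF subring_B] by simp

lemma tr_add: "y \<in> B \<Longrightarrow> y' \<in> B \<Longrightarrow> tr (y + y') = tr y + tr y'"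
  using tr_linear[of 1 y y'] subring_1[OF subring_A] by simp

lemma tr_scale: "a \<in> A \<Longrightarrow> y \<in> B \<Longrightarrow> tr (a * y) = a * tr y"
  using tr_linear[of a y 0] subring_0[OF subring_B] by simp

lemma tr_sum: "(\<And>i. i \<in> I \<Longrightarrow> f i \<in> B) \<Longrightarrow> tr (\<Sum>i\<in>I. f i) = (\<Sum>i\<in>I. tr (f i))"
  by (induction I rule: infinite_finite_induct) (auto simp: tr_add subring_sum[OF subring_B])

lemma scale_in_B: "a \<in> A \<Longrightarrow> y \<in> B \<Longrightarrow> a * y \<in> B"
  using A_subset_B subring_mult[OF subring_B] by blast

lemma trace_of_combination:
  fixes r :: nat
  assumes "\<And>i. i < r \<Longrightarrow> f i \<in> B" "\<And>i. i < r \<Longrightarrow> g i \<in> B"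
    and dual: "\<And>i j. i < r \<Longrightarrow> j < r \<Longrightarrow> tr (f i * g j) = (if i = j then 1 else 0)"
    and a: "\<And>i. i < r \<Longrightarrow> a i \<in> A" and "j < r"
  shows "tr ((\<Sum>i<r. a i * f i) * g j) = a j"
proof -
  have "tr ((\<Sum>i<r. a i * f i) * g j) = tr (\<Sum>i<r. a i * (f i * g j))"
    by (simp add: sum_distrib_right mult.assoc)
  also have "\<dots> = (\<Sum>i<r. a i * tr (f i * g j))"
    using assms by (subst tr_sum) (auto simp: tr_scale scale_in_B subring_mult[OF subring_B])
  also have "\<dots> = (\<Sum>i<r. if i = j then a i else 0)"
    using dual \<open>j < r\<close> by (intro sum.cong) auto
  finally show ?thesis using \<open>j < r\<close> by simp
qed

lemma free_basis_if_dual: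
  assumes f: "\<And>i. i < r \<Longrightarrow> f i \<in> B" and g: "\<And>i. i < r \<Longrightarrow> g i \<in> B"
    and dual: "\<And>i j. i < r \<Longrightarrow> j < r \<Longrightarrow> tr (f i * g j) = (if i = j then 1 else 0)"
    and expand: "\<And>y. y \<in> B \<Longrightarrow> y = (\<Sum>i<r. tr (y * g i) * f i)"
  shows "free_basis A B r f"
  unfolding free_basis_def
proof (intro conjI allI ballI impI)
  fix y assume y: "y \<in> B"
  let ?a = "\<lambda>i. if i < r then tr (y * g i) else 0"
  show "\<exists>!a. (\<forall>i<r. a i \<in> A) \<and> (\<forall>i. r \<le> i \<longrightarrow> a i = 0) \<and> y = (\<Sum>i<r. a i * f i)"
  proof (rule ex1I[of _ ?a])
    show "(\<forall>i<r. ?a i \<in> A) \<and> (\<forall>i. r \<le> i \<longrightarrow> ?a i = 0) \<and> y = (\<Sum>i<r. ?a i * f i)"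
      using expand[OF y] y g by (auto simp: tr_in subring_mult[OF subring_B])
  next
    fix a assume a: "(\<forall>i<r. a i \<in> A) \<and> (\<forall>i. r \<le> i \<longrightarrow> a i = 0) \<and> y = (\<Sum>i<r. a i * f i)"
    then have "tr (y * g j) = a j" if "j < r" for j
      using trace_of_combination[of r f g a j] f g dual that by simp
    then show "a = ?a" using a by (auto simp: fun_eq_iff)
  qed
qed (rule f)

text \<open>The two expansions hold because \<open>f\<close> spans and therefore the trace form is non-degenerate.\<close>
lemma dual_basesI:
  assumes f: "\<And>i. i < r \<Longrightarrow> f i \<in> B" and g: "\<And>i. i < r \<Longrightarrow> g i \<in> B"
    and dual: "\<And>i j. i < r \<Longrightarrow> j < r \<Longrightarrow> tr (f i * g j) = (if i = j then 1 else 0)"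
    and span: "\<And>y. y \<in> B \<Longrightarrow> \<exists>a. (\<forall>i<r. a i \<in> A) \<and> y = (\<Sum>i<r. a i * f i)"
  shows "dual_bases A B tr r f g"
    and "y \<in> B \<Longrightarrow> y = (\<Sum>i<r. tr (y * g i) * f i)"
    and "y \<in> B \<Longrightarrow> y = (\<Sum>i<r. tr (y * f i) * g i)"
proof -
  have mult_B: "x * y \<in> B" if "x \<in> B" "y \<in> B" for x y
    using that by (rule subring_mult[OF subring_B])
  have expand_f: "y = (\<Sum>i<r. tr (y * g i) * f i)" if y: "y \<in> B" for y
  proof -
    obtain a where a: "\<And>i. i < r \<Longrightarrow> a i \<in> A" "y = (\<Sum>i<r. a i * f i)"
      using span[OF y] by blast
    then have "tr (y * g j) = a j" if "j < r" for j
      using trace_of_combination[of r f g a j] f g dual that by simp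
    then show ?thesis using a(2) by simp
  qed
  have expand_g: "y = (\<Sum>i<r. tr (y * f i) * g i)" if y: "y \<in> B" for y
  proof -
    \<comment> \<open>The error of the second expansion is orthogonal to every \<open>f j\<close>,
      hence to all of \<open>B\<close>, and the first expansion of \<open>z\<close> then gives
      0.\<close>
    define z where "z = y - (\<Sum>i<r. tr (y * f i) * g i)"
    have sum_B: "(\<Sum>i<r. tr (y * f i) * g i) \<in> B"
      by (intro subring_sum[OF subring_B] scale_in_B tr_in mult_B) (auto simp: y f g)
    have z: "z \<in> B"
      unfolding z_def using y sum_B by (rule subring_diff[OF subring_B])
    have z_f: "tr (z * f j) = 0" if "j < r" for j
    proof -
      have "tr ((\<Sum>i<r. tr (y * f i) * g i) * f j) = tr (y * f j)"
        using f g dual y that by (intro trace_of_combination) (auto simp: mult.commute tr_in mult_B)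
      moreover have "tr (y * f j) = tr (z * f j + (\<Sum>i<r. tr (y * f i) * g i) * f j)"
        by (simp add: z_def algebra_simps)
      ultimately show ?thesis
        using f that sum_B z by (simp add: tr_add mult_B)
    qed
    have "tr (z * w) = 0" if w: "w \<in> B" for w
    proof -
      have "tr (z * w) = tr (\<Sum>i<r. tr (w * g i) * (z * f i))"
        by (subst expand_f[OF w]) (simp add: sum_distrib_left mult_ac)
      also have "\<dots> = (\<Sum>i<r. tr (w * g i) * tr (z * f i))"
        using f g w z by (subst tr_sum) (auto simp: tr_scale tr_in mult_B scale_in_B)
      finally show ?thesis by (simp add: z_f)
    qed
    then have "z = 0"
      using expand_f[OF z] g by simp
    then show ?thesis by (simp add: z_def)
  qed
  show "dual_bases A B tr r f g"
    unfolding dual_bases_def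
  proof (intro conjI allI impI)
    show "free_basis A B r f"
      using f g dual expand_f by (rule free_basis_if_dual)
    show "free_basis A B r g"
      using g f _ expand_g by (rule free_basis_if_dual) (auto simp: dual mult.commute)
  qed (auto simp: dual)
  show "y \<in> B \<Longrightarrow> y = (\<Sum>i<r. tr (y * g i) * f i)" by (rule expand_f)
  show "y \<in> B \<Longrightarrow> y = (\<Sum>i<r. tr (y * f i) * g i)" by (rule expand_g)
qed

context
  fixes r f g
  assumes db: "dual_bases A B tr r f g"
begin

lemma dual_in_B: "i < r \<Longrightarrow> f i \<in> B" "i < r \<Longrightarrow> g i \<in> B"
  using db by (auto simp: dual_bases_def free_basis_def)

lemma dual_tr: "i < r \<Longrightarrow> j < r \<Longrightarrow> tr (f i * g j) = (if i = j then 1 else 0)"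
  using db by (auto simp: dual_bases_def)

lemma dual_span:
  assumes "y \<in> B" shows "\<exists>a. (\<forall>i<r. a i \<in> A) \<and> y = (\<Sum>i<r. a i * f i)"
proof -
  have "\<exists>!a. (\<forall>i<r. a i \<in> A) \<and> (\<forall>i. r \<le> i \<longrightarrow> a i = 0) \<and> y = (\<Sum>i<r. a i * f i)"
    using db assms by (simp add: dual_bases_def free_basis_def)
  then show ?thesis by (metis (no_types, lifting))
qed

lemma dual_expand:
  "y \<in> B \<Longrightarrow> y = (\<Sum>i<r. tr (y * g i) * f i)" "y \<in> B \<Longrightarrow> y = (\<Sum>i<r. tr (y * f i) * g i)"
  by (rule dual_basesI(2,3)[OF dual_in_B dual_tr dual_span]; assumption)+

end

text \<open>Balanced biadditive maps stand in for linear maps out of the tensor product, so this is the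
  independence of the comultiplication element of the dual bases.\<close>
lemma dual_bases_independent:
  fixes \<phi> :: "'a \<Rightarrow> 'a \<Rightarrow> 'c::ab_group_add"
  assumes addl: "\<And>b b' c. b \<in> B \<Longrightarrow> b' \<in> B \<Longrightarrow> c \<in> B \<Longrightarrow> \<phi> (b + b') c = \<phi> b c + \<phi> b' c"
    and addr: "\<And>b c c'. b \<in> B \<Longrightarrow> c \<in> B \<Longrightarrow> c' \<in> B \<Longrightarrow> \<phi> b (c + c') = \<phi> b c + \<phi> b c'"
    and bal: "\<And>a b c. a \<in> A \<Longrightarrow> b \<in> B \<Longrightarrow> c \<in> B \<Longrightarrow> \<phi> (a * b) c = \<phi> b (a * c)"
    and db: "dual_bases A B tr r f g" and db': "dual_bases A B tr r' f' g'"
  shows "(\<Sum>i<r. \<phi> (f i) (g i)) = (\<Sum>j<r'. \<phi> (f' j) (g' j))"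
proof -
  have zerol: "\<phi> 0 c = 0" if "c \<in> B" for c
    using addl[of 0 0 c] that subring_0[OF subring_B] by simp
  have zeror: "\<phi> c 0 = 0" if "c \<in> B" for c
    using addr[of c 0 0] that subring_0[OF subring_B] by simp
  have suml: "\<phi> (\<Sum>i\<in>I. h i) c = (\<Sum>i\<in>I. \<phi> (h i) c)" if "finite I" "\<And>i. i \<in> I \<Longrightarrow> h i \<in> B" "c \<in> B" for h c and I :: "nat set"
    using that by (induction I rule: finite_induct) (auto simp: zerol addl subring_sum[OF subring_B])
  have sumr: "\<phi> c (\<Sum>i\<in>I. h i) = (\<Sum>i\<in>I. \<phi> c (h i))" if "finite I" "\<And>i. i \<in> I \<Longrightarrow> h i \<in> B" "c \<in> B" for h c and I :: "nat set"
    using that by (induction I rule: finite_induct) (auto simp: zeror addr subring_sum[OF subring_B])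
  note B = dual_in_B[OF db] dual_in_B[OF db']
  have trA: "tr (f i * g' j) \<in> A" if "i < r" "j < r'" for i j
    using that B by (intro tr_in subring_mult[OF subring_B]) auto
  \<comment> \<open>Expand \<open>f i\<close> in the basis \<open>f'\<close>, move the scalars to
    the other argument, and recognise the expansion of \<open>g' j\<close> in the basis
    \<open>g\<close>.\<close>
  have "(\<Sum>i<r. \<phi> (f i) (g i)) = (\<Sum>i<r. \<phi> (\<Sum>j<r'. tr (f i * g' j) * f' j) (g i))"
    using dual_expand(1)[OF db'] B by (intro sum.cong) auto
  also have "\<dots> = (\<Sum>i<r. \<Sum>j<r'. \<phi> (f' j) (tr (f i * g' j) * g i))"
  proof (rule sum.cong[OF refl])
    fix i assume i: "i \<in> {..<r}"
    have "\<phi> (\<Sum>j<r'. tr (f i * g' j) * f' j) (g i) = (\<Sum>j<r'. \<phi> (tr (f i * g' j) * f' j) (g i))"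
      using i B trA by (intro suml) (auto simp: scale_in_B)
    also have "\<dots> = (\<Sum>j<r'. \<phi> (f' j) (tr (f i * g' j) * g i))"
      using i B trA by (intro sum.cong) (auto simp: bal)
    finally show "\<phi> (\<Sum>j<r'. tr (f i * g' j) * f' j) (g i) = (\<Sum>j<r'. \<phi> (f' j) (tr (f i * g' j) * g i))" .
  qed
  also have "\<dots> = (\<Sum>j<r'. \<Sum>i<r. \<phi> (f' j) (tr (f i * g' j) * g i))"
    by (rule sum.swap)
  also have "\<dots> = (\<Sum>j<r'. \<phi> (f' j) (\<Sum>i<r. tr (g' j * f i) * g i))"
    using B trA by (intro sum.cong refl, subst sumr) (auto simp: scale_in_B mult.commute[of "g' _"])
  also have "\<dots> = (\<Sum>j<r'. \<phi> (f' j) (g' j))"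
    using dual_expand(2)[OF db] B by (intro sum.cong) auto
  finally show ?thesis .
qed

text \<open>Each diagonal product has trace 1; this is the source of the values 2m and m.\<close>

lemma dual_bases_trace_sum:
  assumes "dual_bases A B tr r f g"
  shows "tr (\<Sum>i<r. f i * g i) = of_nat r"
  using assms by (subst tr_sum) (auto simp: dual_in_B dual_tr subring_mult[OF subring_B])

end

section \<open>Products of linear factors\<close>

lemma ring_hom_map_poly:
  assumes "ring_hom_fun h" shows "ring_hom_fun (map_poly h)"
  unfolding ring_hom_fun_def
proof (intro conjI allI)
  show "map_poly h 1 = 1"
    by (simp add: rhom_1[OF assms])
  show "map_poly h (a + b) = map_poly h a + map_poly h b" for a b
    by (rule poly_eqI) (simp add: coeff_map_poly rhom_0[OF assms] rhom_add[OF assms])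
  show "map_poly h (a * b) = map_poly h a * map_poly h b" for a b
    by (rule poly_eqI) (simp add: coeff_map_poly rhom_0[OF assms] coeff_mult rhom_sum[OF assms] rhom_mult[OF assms])
qed

lemma coeff_linear_mult_Suc: "coeff ([:- x, 1:] * p) (Suc n) = coeff p n - x * coeff p (Suc n)"
  for x :: "'a::comm_ring_1"
  by simp

lemma coeff_linear_mult_0: "coeff ([:- x, 1:] * p) 0 = - x * coeff p 0"
  for x :: "'a::comm_ring_1"
  by simp

lemma prod_linear_monic:
  fixes x :: "'i \<Rightarrow> 'a::comm_ring_1"
  assumes "finite I"
  shows "coeff (\<Prod>i\<in>I. [:- x i, 1:]) (card I) = 1 \<and> (\<forall>n>card I. coeff (\<Prod>i\<in>I. [:- x i, 1:]) n = 0)"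
  using assms
proof (induction I rule: finite_induct)
  case (insert i I)
  then show ?case
    by (auto simp del: mult_pCons_left simp: coeff_linear_mult_Suc gr0_conv_Suc Suc_less_eq2)
qed auto

text \<open>Beyond the top degree the stated degree is negative, which is consistent because the
  coefficient is 0 there.\<close>

lemma homog_prod_linear:
  assumes "finite I" "\<And>i. i \<in> I \<Longrightarrow> homog (x i) 2"
  shows "homog (coeff (\<Prod>i\<in>I. [:- x i, 1:]) n) (2 * (int (card I) - int n))"
  using assms
proof (induction I arbitrary: n rule: finite_induct)
  case empty
  then show ?case
    by (cases n) (auto simp: homog_1)
next
  case (insert i I)
  have x: "homog (x i) 2" using insert by simp
  have IH: "homog (coeff (\<Prod>i\<in>I. [:- x i, 1:]) n) (2 * (int (card I) - int n))" for n
    using insert by simp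
  have "homog (x i * coeff (\<Prod>i\<in>I. [:- x i, 1:]) n) (2 * (int (card I) - int n) + 2)" for n
    using homog_mult[OF x IH[of n]] by (simp add: algebra_simps)
  note xn = this
  show ?case
  proof (cases n)
    case 0
    then show ?thesis using insert homog_minus[OF xn[of 0]]
      by (simp del: mult_pCons_left add: coeff_linear_mult_0 algebra_simps)
  next
    case (Suc k)
    then show ?thesis using insert homog_diff[OF IH[of k]] xn[of "Suc k"]
      by (simp del: mult_pCons_left add: coeff_linear_mult_Suc algebra_simps)
  qed
qed

lemma poly_as_sum:
  fixes p :: "'a::comm_ring_1 poly"
  assumes "\<And>i. n \<le> i \<Longrightarrow> coeff p i = 0"
  shows "poly p x = (\<Sum>i<n. coeff p i * x ^ i)"
proof -
  have "poly p x = (\<Sum>i\<le>degree p. coeff p i * x ^ i)"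
    by (rule poly_altdef)
  also have "\<dots> = (\<Sum>i<max n (Suc (degree p)). coeff p i * x ^ i)"
    by (rule sum.mono_neutral_left) (auto simp: coeff_eq_0)
  also have "\<dots> = (\<Sum>i<n. coeff p i * x ^ i)"
    by (rule sum.mono_neutral_right) (auto simp: assms not_less)
  finally show ?thesis .
qed

section \<open>The orbit of a fundamental weight\<close>

context dihedral
begin

text \<open>The generator that moves the j-th orbit element to the next one. It starts with
  \<open>\<not> u\<close> because \<open>u\<close> fixes the weight at the beginning of the
  orbit.\<close>

definition letter :: "bool \<Rightarrow> nat \<Rightarrow> bool" where
  "letter u j = (if even j then \<not> u else u)"

lemma letter_Suc: "letter u (Suc j) = (\<not> letter u j)"
  by (simp add: letter_def)

lemma letter_0 [simp]: "letter u 0 = (\<not> u)"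
  by (simp add: letter_def)

text \<open>\<open>alt\<close> recurses on its first letter, whereas a growing composite of
  operators needs the last one: after \<open>rev\<close>, the new letter is the operator applied
  last.\<close>

lemma alt_snoc: "alt (\<not> u) (Suc k) = alt (\<not> u) k @ [letter u k]"
proof (induction k arbitrary: u)
  case (Suc k)
  have "alt (\<not> u) (Suc (Suc k)) = (\<not> u) # alt u (Suc k)" by simp
  also have "alt u (Suc k) = alt u k @ [letter (\<not> u) k]" using Suc[of "\<not> u"] by simp
  finally show ?case by (simp add: letter_def)
qed simp

text \<open>The orbit of the weight fixed by \<open>u\<close>, in the order in which it is reached by applying
  the letters alternately.\<close>
definition X :: "bool \<Rightarrow> nat \<Rightarrow> ('n, 'k) mpoly" where
  "X u j = mconst (qn q (Suc j)) * P (letter u j) - mconst (qn q j) * P (\<not> letter u j)"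

lemma X_0: "X u 0 = P (\<not> u)"
  by (simp add: X_def)

lemma X_Suc: "X u j - X u (Suc j) = mconst (qn q (Suc j)) * \<alpha> (letter u j)"
  unfolding X_def alpha_eq[of "letter u j"]
  by (simp add: letter_Suc mconst_diff mconst_mult algebra_simps)

lemma S_letter_X: "S (letter u j) (X u j) = X u (Suc j)"
proof -
  have "S (letter u j) (X u j) = X u j - mconst (qn q (Suc j)) * \<alpha> (letter u j)"
    by (simp add: X_def ract_diff ract_mult S_P_self S_P_other algebra_simps)
  then show ?thesis using X_Suc[of u j] by (simp add: algebra_simps)
qed

lemma S_letter_X_Suc: "S (letter u j) (X u (Suc j)) = X u j"
  by (simp add: S_letter_X[symmetric] S_S)

lemma S_X_0: "S u (X u 0) = X u 0"
  by (simp add: X_0 S_P_other)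

text \<open>[m] = 0 closes the path: the letter that would lead out of the last orbit element fixes
  it.\<close>

lemma X_last: "X u m = X u (m - 1)"
  using X_Suc[of u "m - 1"] m_ge_2 qn_m by simp

lemma homog_X: "homog (X u j) 2"
  unfolding X_def using homog_mult[OF homog_mconst homog_lin] by (auto intro: homog_diff)

text \<open>\<open>G u 0\<close> is the orbit polynomial F, and \<open>G u (Suc 0)\<close> is F / (T
  - X 0); each further index drops one more factor.\<close>

definition G :: "bool \<Rightarrow> nat \<Rightarrow> ('n, 'k) mpoly poly" where
  "G u k = (\<Prod>j\<in>{k..<m}. [:- X u j, 1:])"

lemma G_step: "k < m \<Longrightarrow> G u k = [:- X u k, 1:] * G u (Suc k)"
  unfolding G_def by (simp add: prod.atLeast_Suc_lessThan del: mult_pCons_left)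

lemma G_ge_m: "m \<le> k \<Longrightarrow> G u k = 1"
  by (simp add: G_def)

abbreviation mapS :: "bool \<Rightarrow> ('n, 'k) mpoly poly \<Rightarrow> ('n, 'k) mpoly poly" where
  "mapS v \<equiv> map_poly (S v)"

lemmas mapS_mult = rhom_mult[OF ring_hom_map_poly[OF ring_hom_ract]]

lemma mapS_linear: "mapS v [:- x, 1:] = [:- S v x, 1:]"
  by (simp add: map_poly_pCons ract_minus)

text \<open>The letter swaps \<open>X u k\<close> with \<open>X u (Suc k)\<close>, and, recurring
  with period two, each later pair of neighbours in the same way. A factor left unpaired at the end
  is fixed by \<open>X_last\<close>.\<close>

lemma mapS_letter_G: "mapS (letter u k) (G u k) = G u k"
proof (induction "m - k" arbitrary: k rule: less_induct)
  case less
  consider "m \<le> k" | "Suc k = m" | "Suc k < m" by linarith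
  then show ?case
  proof cases
    case 1
    then show ?thesis by (simp add: G_ge_m)
  next
    case 2
    then have "G u k = [:- X u k, 1:]" by (simp add: G_step[of k] G_ge_m)
    moreover have "X u (Suc k) = X u k" using X_last[of u] 2 by auto
    ultimately show ?thesis by (simp add: mapS_linear S_letter_X)
  next
    case 3
    then have G: "G u k = [:- X u k, 1:] * ([:- X u (Suc k), 1:] * G u (Suc (Suc k)))"
      by (simp add: G_step[of k] G_step[of "Suc k"] del: mult_pCons_left)
    have "letter u (Suc (Suc k)) = letter u k"
      by (simp add: letter_Suc)
    then have "mapS (letter u k) (G u (Suc (Suc k))) = G u (Suc (Suc k))"
      using less[of "Suc (Suc k)"] 3 by simp
    then show ?thesis
      unfolding G mapS_mult mapS_linear S_letter_X S_letter_X_Suc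
      by (simp del: mult_pCons_left add: mult.left_commute)
  qed
qed

lemma mapS_G_1: "mapS u (G u (Suc 0)) = G u (Suc 0)"
  using mapS_letter_G[of u 1] by (simp add: letter_def)

text \<open>The letter \<open>\<not> u\<close> pairs the factors from index 0 on; \<open>u\<close>
  fixes \<open>X u 0\<close> and pairs them from index 1 on.\<close>

lemma mapS_G_0: "mapS v (G u 0) = G u 0"
proof (cases "v = u")
  case True
  have "0 < m" using m_ge_2 by simp
  then show ?thesis
    using True mapS_G_1[of u] by (simp add: G_step[of 0] mapS_mult mapS_linear S_X_0 del: mult_pCons_left)
next
  case False
  then show ?thesis using mapS_letter_G[of u 0] by (auto simp: letter_def)
qed

lemma coeff_G_0_in_RW: "coeff (G u 0) i \<in> RW"
  using mapS_G_0[of _ u] by (auto simp: Rinv_iff poly_eq_iff coeff_map_poly)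

lemma coeff_G_1_in_Ru: "coeff (G u (Suc 0)) i \<in> Ru u"
  using mapS_G_1[of u] by (auto simp: Rinv_iff poly_eq_iff coeff_map_poly)

text \<open>The letter fixes the tail \<open>G u (Suc (Suc k))\<close>, so only T - X (k+1) is
  differentiated, and its image under the letter is T - X k. The difference X k - X (k+1) is [k+1]
  times the simple root.\<close>

lemma D_coeff_G:
  assumes "Suc k < m"
  shows "D (letter u k) (coeff (G u (Suc k)) i) = mconst (qn q (Suc k)) * coeff (G u (Suc (Suc k))) i"
proof (rule D_eqI)
  let ?G = "G u (Suc (Suc k))"
  have G: "G u (Suc k) = [:- X u (Suc k), 1:] * ?G"
    using assms by (rule G_step)
  have "letter u (Suc (Suc k)) = letter u k"
    by (simp add: letter_Suc)
  then have "mapS (letter u k) ?G = ?G"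
    using mapS_letter_G[of u "Suc (Suc k)"] by simp
  then have "mapS (letter u k) (G u (Suc k)) = [:- X u k, 1:] * ?G"
    unfolding G mapS_mult mapS_linear S_letter_X_Suc by simp
  then have "G u (Suc k) - mapS (letter u k) (G u (Suc k)) = ([:- X u (Suc k), 1:] - [:- X u k, 1:]) * ?G"
    unfolding G left_diff_distrib by simp
  also have "\<dots> = smult (X u k - X u (Suc k)) ?G"
    by simp
  finally have "coeff (G u (Suc k) - mapS (letter u k) (G u (Suc k))) i = (X u k - X u (Suc k)) * coeff ?G i"
    by (metis coeff_smult)
  then show "\<alpha> (letter u k) * (mconst (qn q (Suc k)) * coeff ?G i) =
      coeff (G u (Suc k)) i - S (letter u k) (coeff (G u (Suc k)) i)"
    by (simp add: coeff_map_poly X_Suc mult_ac)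
qed

lemma G_0_monic: "coeff (G u 0) m = 1" "m < i \<Longrightarrow> coeff (G u 0) i = 0"
  using prod_linear_monic[of "{0..<m}" "X u"] by (auto simp: G_def)

lemma G_1_monic: "coeff (G u (Suc 0)) (m - Suc 0) = 1" "m \<le> i \<Longrightarrow> coeff (G u (Suc 0)) i = 0"
  using prod_linear_monic[of "{1..<m}" "X u"] m_ge_2 by (auto simp: G_def)

lemma homog_coeff_G_1: "homog (coeff (G u (Suc 0)) i) (2 * (int m - 1 - int i))"
  using homog_prod_linear[of "{1..<m}" "X u" i] m_ge_2 by (simp add: G_def homog_X of_nat_diff)

text \<open>Coefficient comparison in F = (T - X 0) G: multiplication by X 0 shifts the coefficients
  of G up to elements of R^W.\<close>

lemma horner_G:
  "X u 0 * coeff (G u (Suc 0)) 0 = - coeff (G u 0) 0"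
  "X u 0 * coeff (G u (Suc 0)) (Suc j) = coeff (G u (Suc 0)) j - coeff (G u 0) (Suc j)"
proof -
  have "0 < m" using m_ge_2 by simp
  then have G: "G u 0 = [:- X u 0, 1:] * G u (Suc 0)" by (simp add: G_step[of 0] del: mult_pCons_left)
  show "X u 0 * coeff (G u (Suc 0)) 0 = - coeff (G u 0) 0"
    unfolding G coeff_linear_mult_0 by simp
  show "X u 0 * coeff (G u (Suc 0)) (Suc j) = coeff (G u (Suc 0)) j - coeff (G u 0) (Suc j)"
    unfolding G coeff_linear_mult_Suc by simp
qed

section \<open>Traces of powers of a weight\<close>

text \<open>Treats \<open>dsW\<close> (\<open>u\<close> true) and \<open>dtW\<close>
  (\<open>u\<close> false) together; \<open>D (\<not> u)\<close> is applied first.\<close>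

definition tr :: "bool \<Rightarrow> ('n, 'k) mpoly \<Rightarrow> ('n, 'k) mpoly" where
  "tr u = dem_comp Rz (rev (alt (\<not> u) (m - 1)))"

definition qfact :: "('n, 'k) mpoly" where
  "qfact = mconst (\<Prod>j=1..m-1. qn q j)"

lemma D_RW_linear: "a \<in> RW \<Longrightarrow> D u (a * f) = a * D u f"
  using D_linear RW_subset_Ru by blast

lemma dem_comp_linear: "a \<in> RW \<Longrightarrow> dem_comp Rz w (a * f + g) = a * dem_comp Rz w f + dem_comp Rz w g"
  by (induction w) (simp_all add: D_add D_RW_linear)

lemma tr_RW_linear: "a \<in> RW \<Longrightarrow> tr u (a * f + g) = a * tr u f + tr u g"
  unfolding tr_def by (rule dem_comp_linear)

lemma dem_comp_coeff_G:
  "k \<le> m - 1 \<Longrightarrow> dem_comp Rz (rev (alt (\<not> u) k)) (coeff (G u (Suc 0)) i) =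
    mconst (\<Prod>j=1..k. qn q j) * coeff (G u (Suc k)) i"
proof (induction k)
  case (Suc k)
  then show ?case
    using D_coeff_G[of k u i]
    by (simp add: alt_snoc D_linear[OF mconst_in_Rinv] mconst_mult mult_ac del: alt.simps)
qed simp

text \<open>After m - 1 operators the product of linear factors is empty, so the remaining
  polynomial is the constant 1.\<close>

lemma tr_coeff_G: "tr u (coeff (G u (Suc 0)) i) = (if i = 0 then qfact else 0)"
  using dem_comp_coeff_G[of "m - 1" u i] m_ge_2
  by (auto simp: tr_def qfact_def G_ge_m)

lemma tr_0 [simp]: "tr u 0 = 0" and tr_diff: "tr u (f - g) = tr u f - tr u g"
  and tr_scale: "a \<in> RW \<Longrightarrow> tr u (a * f) = a * tr u f"
  and tr_add: "tr u (f + g) = tr u f + tr u g"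
proof -
  have 1: "1 \<in> RW" by (rule subring_1[OF subring_Rinv])
  show 0: "tr u 0 = 0" using tr_RW_linear[OF 1, of u 0 0] by simp
  show "tr u (f - g) = tr u f - tr u g"
    using tr_RW_linear[OF 1, of u "f - g" g] by simp
  show "a \<in> RW \<Longrightarrow> tr u (a * f) = a * tr u f"
    using tr_RW_linear[of a u f 0] 0 by simp
  show "tr u (f + g) = tr u f + tr u g"
    using tr_RW_linear[OF 1, of u f g] by simp
qed

text \<open>Horner's relation trades one power of \<open>X u 0\<close> for a shift of the
  coefficient index, with an error that is an R^W-multiple of a lower power of \<open>X u 0\<close>
  and has trace 0.\<close>

lemma tr_dual:
  assumes "i < m" "j < m"
  shows "tr u (X u 0 ^ i * coeff (G u (Suc 0)) j) = (if i = j then qfact else 0)"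
  using assms
proof (induction i arbitrary: j)
  case 0
  then show ?case by (simp add: tr_coeff_G)
next
  case (Suc i)
  \<comment> \<open>The coefficient of index m - 1 is 1 and i < m - 1, so the induction hypothesis
    shows that the bare power has trace 0.\<close>
  have "tr u (X u 0 ^ i * coeff (G u (Suc 0)) (m - 1)) = 0"
    using Suc by simp
  then have power: "tr u (X u 0 ^ i) = 0"
    by (simp add: G_1_monic)
  show ?case
  proof (cases j)
    case 0
    have "X u 0 ^ Suc i * coeff (G u (Suc 0)) 0 = (- coeff (G u 0) 0) * X u 0 ^ i"
      unfolding horner_G(1)[symmetric] by (simp add: mult_ac)
    then show ?thesis
      using 0 tr_scale[OF subring_minus[OF subring_Rinv coeff_G_0_in_RW], of u u 0 "X u 0 ^ i"]
      by (simp add: power del: power_Suc)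
  next
    case (Suc l)
    have "X u 0 ^ Suc i * coeff (G u (Suc 0)) (Suc l) =
        X u 0 ^ i * (X u 0 * coeff (G u (Suc 0)) (Suc l))"
      by (simp add: mult_ac)
    also have "\<dots> = X u 0 ^ i * coeff (G u (Suc 0)) l - coeff (G u 0) (Suc l) * X u 0 ^ i"
      unfolding horner_G(2) by (simp add: algebra_simps)
    finally show ?thesis
      using Suc Suc.IH[of l] Suc.prems
      by (simp add: tr_diff tr_scale coeff_G_0_in_RW power del: power_Suc)
  qed
qed

lemma tr_X_power: "i < m \<Longrightarrow> tr u (X u 0 ^ i) = (if i = m - 1 then qfact else 0)"
  using tr_dual[of i "m - 1" u] m_ge_2 by (simp add: G_1_monic)

end

lemma dem_comp_append: "dem_comp Rz (v @ w) f = dem_comp Rz v (dem_comp Rz w f)"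
  by (induction v) simp_all

lemma length_alt [simp]: "length (alt b n) = n"
  by (induction n arbitrary: b) simp_all

lemma sum_pairs: "(\<Sum>n<2 * m. h n) = (\<Sum>i<m. h (2 * i) + h (Suc (2 * i)))"
  for m :: nat and h :: "nat \<Rightarrow> 'a::comm_monoid_add"
  by (induction m) (simp_all add: add.assoc)

context dihedral
begin

section \<open>Spanning over the invariants\<close>

text \<open>One index carries both exponents, \<open>n div 2\<close> for \<open>X u 0\<close> and
  \<open>n mod 2\<close> for \<open>P u\<close>, because bases are families indexed by an initial
  segment of the naturals.\<close>

definition E :: "bool \<Rightarrow> nat \<Rightarrow> ('n, 'k) mpoly" where
  "E u n = X u 0 ^ (n div 2) * (if even n then 1 else P u)"

definition inv_span :: "bool \<Rightarrow> ('n, 'k) mpoly set" where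
  "inv_span u = {p. \<exists>c. (\<forall>n<2 * m. c n \<in> RW) \<and> p = (\<Sum>n<2 * m. c n * E u n)}"

lemma inv_span_E: "n < 2 * m \<Longrightarrow> E u n \<in> inv_span u"
  unfolding inv_span_def
  by (intro CollectI exI[of _ "\<lambda>i. if i = n then 1 else 0"])
    (auto simp: if_distrib[of "\<lambda>x. x * _"] subring_0[OF subring_Rinv] subring_1[OF subring_Rinv] cong: if_cong)

lemma inv_span_add: "p \<in> inv_span u \<Longrightarrow> p' \<in> inv_span u \<Longrightarrow> p + p' \<in> inv_span u"
proof -
  assume "p \<in> inv_span u" "p' \<in> inv_span u"
  then obtain c c' where "\<forall>n<2 * m. c n \<in> RW" "p = (\<Sum>n<2 * m. c n * E u n)"
    "\<forall>n<2 * m. c' n \<in> RW" "p' = (\<Sum>n<2 * m. c' n * E u n)"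
    unfolding inv_span_def by blast
  then show ?thesis
    unfolding inv_span_def
    by (intro CollectI exI[of _ "\<lambda>n. c n + c' n"])
      (auto simp: sum.distrib distrib_right subring_add[OF subring_Rinv])
qed

lemma inv_span_scale: "a \<in> RW \<Longrightarrow> p \<in> inv_span u \<Longrightarrow> a * p \<in> inv_span u"
proof -
  assume a: "a \<in> RW" and "p \<in> inv_span u"
  then obtain c where "\<forall>n<2 * m. c n \<in> RW" "p = (\<Sum>n<2 * m. c n * E u n)"
    unfolding inv_span_def by blast
  then show ?thesis
    unfolding inv_span_def using a
    by (intro CollectI exI[of _ "\<lambda>n. a * c n"])
      (auto simp: sum_distrib_left mult.assoc subring_mult[OF subring_Rinv])
qed

lemma inv_span_sum: "finite I \<Longrightarrow> (\<And>i. i \<in> I \<Longrightarrow> f i \<in> inv_span u) \<Longrightarrow> (\<Sum>i\<in>I. f i) \<in> inv_span u"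
proof (induction I rule: finite_induct)
  case empty
  show ?case
    using inv_span_scale[OF subring_0[OF subring_Rinv] inv_span_E[of 0 u]] m_ge_2 by simp
qed (auto simp: inv_span_add)

lemma inv_span_diff: "p \<in> inv_span u \<Longrightarrow> p' \<in> inv_span u \<Longrightarrow> p - p' \<in> inv_span u"
  using inv_span_add[of p u "(- 1) * p'"] inv_span_scale[OF subring_minus[OF subring_Rinv subring_1[OF subring_Rinv]], of p' u]
  by simp

lemma inv_span_if_closed:
  assumes "\<And>n. n < 2 * m \<Longrightarrow> x * E u n \<in> inv_span u" "p \<in> inv_span u"
  shows "x * p \<in> inv_span u"
proof -
  obtain c where c: "\<forall>n<2 * m. c n \<in> RW" "p = (\<Sum>n<2 * m. c n * E u n)"
    using assms(2) unfolding inv_span_def by blast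
  have "x * p = (\<Sum>n<2 * m. c n * (x * E u n))"
    by (simp add: c(2) sum_distrib_left mult_ac)
  also have "\<dots> \<in> inv_span u"
    using assms(1) c(1) by (auto intro!: inv_span_sum intro: inv_span_scale)
  finally show ?thesis .
qed

text \<open>\<open>X u 0\<close> is a root of its own orbit polynomial, which is monic of degree m
  over R^W.\<close>

lemma X_0_power_m: "X u 0 ^ m = - (\<Sum>l<m. coeff (G u 0) l * X u 0 ^ l)"
proof -
  have "0 < m" using m_ge_2 by simp
  then have "poly (G u 0) (X u 0) = 0"
    by (simp add: G_step[of 0])
  also have "poly (G u 0) (X u 0) = (\<Sum>l<Suc m. coeff (G u 0) l * X u 0 ^ l)"
    by (rule poly_as_sum) (simp add: G_0_monic)
  finally show ?thesis
    by (simp add: G_0_monic eq_neg_iff_add_eq_0 add.commute)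
qed

lemma inv_span_X_0_mult: "p \<in> inv_span u \<Longrightarrow> X u 0 * p \<in> inv_span u"
proof (rule inv_span_if_closed)
  fix n assume n: "n < 2 * m"
  define t where "t = (if even n then 1 else P u)"
  have step: "X u 0 * E u n = X u 0 ^ Suc (n div 2) * t"
    by (simp add: E_def t_def)
  show "X u 0 * E u n \<in> inv_span u"
  proof (cases "Suc (n div 2) < m")
    case True
    have "X u 0 * E u n = E u (n + 2)"
      unfolding step by (simp add: E_def t_def)
    moreover have "n + 2 < 2 * m"
      using True by linarith
    ultimately show ?thesis by (simp add: inv_span_E)
  next
    case False
    then have "Suc (n div 2) = m" using n by linarith
    then have "X u 0 * E u n = (\<Sum>l<m. (- coeff (G u 0) l) * (X u 0 ^ l * t))"
      unfolding step by (simp add: X_0_power_m sum_distrib_right sum_negf mult.assoc)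
    also have "\<dots> = (\<Sum>l<m. (- coeff (G u 0) l) * E u (2 * l + n mod 2))"
      by (intro sum.cong refl) (auto simp: E_def t_def)
    also have "\<dots> \<in> inv_span u"
    proof (intro inv_span_sum inv_span_scale inv_span_E subring_minus[OF subring_Rinv] coeff_G_0_in_RW)
      fix l assume "l \<in> {..<m}"
      then show "2 * l + n mod 2 < 2 * m" by (simp; linarith)
    qed simp
    finally show ?thesis .
  qed
qed

lemma P_square: "\<exists>N\<in>RW. P u ^ 2 = mconst q * P (\<not> u) * P u - P (\<not> u) ^ 2 + N"
  by (rule bexI[OF _ norm_form_in_RW[of u]]) (simp add: algebra_simps)

lemma inv_span_P_mult: "p \<in> inv_span u \<Longrightarrow> P u * p \<in> inv_span u"
proof (rule inv_span_if_closed)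
  fix n assume n: "n < 2 * m"
  show "P u * E u n \<in> inv_span u"
  proof (cases "even n")
    case True
    then have "P u * E u n = E u (Suc n)" by (auto simp: E_def)
    moreover have "Suc n < 2 * m" using n True by presburger
    ultimately show ?thesis by (simp add: inv_span_E)
  next
    case False
    obtain N where N: "N \<in> RW" "P u ^ 2 = mconst q * P (\<not> u) * P u - P (\<not> u) ^ 2 + N"
      using P_square by blast
    have nn: "n - 1 < 2 * m" "even (n - 1)" "(n - 1) div 2 = n div 2"
      using n False by (auto elim: oddE)
    have "P u * E u n = X u 0 ^ (n div 2) * P u ^ 2"
      using False by (simp add: E_def power2_eq_square mult_ac)
    also have "\<dots> = mconst q * (X u 0 * E u n) - X u 0 * (X u 0 * E u (n - 1)) + N * E u (n - 1)"
      unfolding N(2) using False nn by (simp add: E_def X_0 power2_eq_square algebra_simps)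
    also have "\<dots> \<in> inv_span u"
      using n nn by (intro inv_span_add inv_span_diff inv_span_scale inv_span_X_0_mult inv_span_E mconst_in_Rinv N(1))
    finally show ?thesis .
  qed
qed

text \<open>The span contains the constants and is stable under R^W and under both weights, hence by
  \<open>mvar_decomposition\<close> under every variable.\<close>

lemma inv_span_UNIV: "p \<in> inv_span u"
proof (induction p rule: mpoly_induct)
  case (const c)
  have "E u 0 \<in> inv_span u" using m_ge_2 by (intro inv_span_E) simp
  from inv_span_scale[OF mconst_in_Rinv this] show ?case
    by (simp add: E_def)
next
  case (var i p)
  define N where "N = mvar i - mconst (coroot Rz True i) * P True - mconst (coroot Rz False i) * P False"
  have N: "N \<in> RW" unfolding N_def by (rule mvar_decomposition)
  have P: "P v * p \<in> inv_span u" for v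
    using inv_span_P_mult[OF var] inv_span_X_0_mult[OF var] by (cases "v = u") (auto simp: X_0)
  have "mvar i * p = N * p + mconst (coroot Rz True i) * (P True * p) + mconst (coroot Rz False i) * (P False * p)"
    unfolding N_def by (simp add: algebra_simps)
  also have "\<dots> \<in> inv_span u"
    by (intro inv_span_add inv_span_scale[OF mconst_in_Rinv P] inv_span_scale[OF N var])
  finally show ?case .
qed (rule inv_span_add)

lemma expand_E: "\<exists>c. (\<forall>n<2 * m. c n \<in> RW) \<and> p = (\<Sum>n<2 * m. c n * E u n)"
  using inv_span_UNIV[of p u] by (simp add: inv_span_def)

section \<open>The braid relation\<close>

text \<open>The two candidates for the trace of R over R^W, named by the letter applied first;
  \<open>braid\<close> identifies them.\<close>

definition full :: "bool \<Rightarrow> ('n, 'k) mpoly \<Rightarrow> ('n, 'k) mpoly" where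
  "full u f = tr u (D u f)"

lemma full_linear: "a \<in> RW \<Longrightarrow> full u (a * f + g) = a * full u f + full u g"
  by (simp add: full_def D_add D_RW_linear tr_RW_linear)

lemma full_0 [simp]: "full u 0 = 0" and full_add: "full u (f + g) = full u f + full u g"
  and full_scale: "a \<in> RW \<Longrightarrow> full u (a * f) = a * full u f"
  by (simp_all add: full_def D_add D_RW_linear tr_add tr_scale)

lemma full_sum: "full u (\<Sum>i\<in>I. f i) = (\<Sum>i\<in>I. full u (f i))"
  by (induction I rule: infinite_finite_induct) (auto simp: full_add)

lemma X_0_power_in_Ru: "X u 0 ^ i \<in> Ru u"
  by (intro subring_power[OF subring_Rinv]) (simp add: X_0 P_other_in_Ru)

lemma full_X_power: "full u (X u 0 ^ i) = 0"
  by (simp add: full_def D_inv X_0_power_in_Ru)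

lemma full_X_power_P: "i < m \<Longrightarrow> full u (X u 0 ^ i * P u) = (if i = m - 1 then qfact else 0)"
  by (simp add: full_def D_linear X_0_power_in_Ru D_P_self tr_X_power)

text \<open>The norm form equation times a monomial. The term with N lowers the total exponent by 2,
  and the same N serves all exponents.\<close>

lemma full_P_recurrence:
  "\<exists>N\<in>RW. \<forall>i j. full u (X u 0 ^ i * P u ^ (j + 2)) = mconst q * full u (X u 0 ^ Suc i * P u ^ Suc j)
      - full u (X u 0 ^ (i + 2) * P u ^ j) + N * full u (X u 0 ^ i * P u ^ j)"
proof -
  obtain N where N: "N \<in> RW" "P u ^ 2 = mconst q * P (\<not> u) * P u - P (\<not> u) ^ 2 + N"
    using P_square by blast
  have "X u 0 ^ i * P u ^ (j + 2) = X u 0 ^ i * P u ^ j * (P u ^ 2)" for i j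
    by (simp add: power2_eq_square mult_ac)
  then have rec: "X u 0 ^ i * P u ^ (j + 2) = mconst q * (X u 0 ^ Suc i * P u ^ Suc j)
      + (mconst (- 1) * (X u 0 ^ (i + 2) * P u ^ j) + N * (X u 0 ^ i * P u ^ j))" for i j
    unfolding N(2) by (simp add: X_0 power2_eq_square mconst_minus algebra_simps)
  show ?thesis
  proof (intro bexI[OF _ N(1)] allI)
    show "full u (X u 0 ^ i * P u ^ (j + 2)) = mconst q * full u (X u 0 ^ Suc i * P u ^ Suc j)
      - full u (X u 0 ^ (i + 2) * P u ^ j) + N * full u (X u 0 ^ i * P u ^ j)" for i j
      unfolding rec full_linear[OF mconst_in_Rinv] full_scale[OF N(1)] by (simp add: mconst_minus)
  qed
qed

text \<open>In accordance with degrees: m Demazure operators lower the polynomial degree by m. The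
  recurrence reduces the exponent of \<open>P u\<close> to 0 or 1, where the value is known.\<close>

lemma full_low_degree: "i + j < m \<Longrightarrow> full u (X u 0 ^ i * P u ^ j) = 0"
proof (induction j arbitrary: i rule: less_induct)
  case (less j)
  obtain N where N: "N \<in> RW"
    "\<And>i j. full u (X u 0 ^ i * P u ^ (j + 2)) = mconst q * full u (X u 0 ^ Suc i * P u ^ Suc j)
      - full u (X u 0 ^ (i + 2) * P u ^ j) + N * full u (X u 0 ^ i * P u ^ j)"
    using full_P_recurrence by blast
  consider "j = 0" | "j = 1" | k where "j = k + 2"
    by (metis One_nat_def add_2_eq_Suc' not0_implies_Suc)
  then show ?case
  proof cases
    case 1
    then show ?thesis by (simp add: full_X_power)
  next
    case 2
    then show ?thesis using less.prems by (simp add: full_X_power_P)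
  next
    case 3
    show ?thesis
      unfolding 3 N(2)[rule_format] using less 3 by (simp del: power_Suc)
  qed
qed

text \<open>In total degree m the term with N vanishes by \<open>full_low_degree\<close>. What
  remains is the recurrence of the quantum numbers, with initial values 0 and
  \<open>qfact\<close>.\<close>

lemma full_top_degree: "j \<le> m \<Longrightarrow> full u (X u 0 ^ (m - j) * P u ^ j) = mconst (qn q j) * qfact"
proof (induction j rule: less_induct)
  case (less j)
  obtain N where N: "N \<in> RW"
    "\<And>i j. full u (X u 0 ^ i * P u ^ (j + 2)) = mconst q * full u (X u 0 ^ Suc i * P u ^ Suc j)
      - full u (X u 0 ^ (i + 2) * P u ^ j) + N * full u (X u 0 ^ i * P u ^ j)"
    using full_P_recurrence by blast
  consider "j = 0" | "j = 1" | k where "j = k + 2"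
    by (metis One_nat_def add_2_eq_Suc' not0_implies_Suc)
  then show ?case
  proof cases
    case 1
    then show ?thesis by (simp add: full_X_power)
  next
    case 2
    then show ?thesis using full_X_power_P[of "m - 1" u] m_ge_2 by simp
  next
    case 3
    have e: "Suc (m - j) = m - Suc k" "m - j + 2 = m - k" "m - j + k < m"
      using less.prems 3 by auto
    have "full u (X u 0 ^ (m - j) * P u ^ j) =
        mconst q * (mconst (qn q (Suc k)) * qfact) - mconst (qn q k) * qfact"
      using less.IH[of "Suc k"] less.IH[of k] less.prems 3 full_low_degree[OF e(3), of u]
      unfolding N(2)[rule_format, of "m - j" k, folded 3] e by simp
    also have "\<dots> = mconst (qn q j) * qfact"
      by (simp add: 3 mconst_diff mconst_mult algebra_simps)
    finally show ?thesis .
  qed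
qed

text \<open>Exchanging the letters exchanges the two weights, so each \<open>E u n\<close> can be
  read as a monomial for \<open>u\<close> and for \<open>\<not> u\<close>. Only the one with
  \<open>i = m - 1\<close> and odd index has non-zero trace, where [m-1] = 1 makes both values
  \<open>qfact\<close>.\<close>

lemma braid: "full (\<not> u) f = full u f"
proof -
  have E: "full (\<not> u) (E u n) = full u (E u n)" if n: "n < 2 * m" for n
  proof -
    define i where "i = n div 2"
    have i: "i < m" using n by (simp add: i_def; linarith)
    have flip: "X u 0 = P (\<not> u)" "X (\<not> u) 0 = P u" by (simp_all add: X_0)
    show ?thesis
    proof (cases "even n")
      case True
      then have "E u n = X (\<not> u) 0 ^ 0 * P (\<not> u) ^ i"
        by (simp add: E_def i_def flip)
      then have "full (\<not> u) (E u n) = 0"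
        using full_low_degree[of 0 i "\<not> u"] i by simp
      moreover have "full u (E u n) = 0"
        using True by (simp add: E_def full_X_power)
      ultimately show ?thesis by simp
    next
      case False
      then have E: "E u n = X (\<not> u) 0 ^ 1 * P (\<not> u) ^ i" "E u n = X u 0 ^ i * P u"
        by (simp_all add: E_def i_def flip)
      show ?thesis
      proof (cases "i = m - 1")
        case True
        have "X (\<not> u) 0 ^ 1 * P (\<not> u) ^ i = X (\<not> u) 0 ^ (m - i) * P (\<not> u) ^ i"
          using True m_ge_2 by simp
        then have "full (\<not> u) (E u n) = qfact"
          using full_top_degree[of i "\<not> u"] i unfolding E(1) by (simp add: True qn_m_minus_1[unfolded One_nat_def])
        moreover have "full u (E u n) = qfact"
          using full_X_power_P[OF i, of u] True unfolding E(2) by simp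
        ultimately show ?thesis by simp
      next
        case False
        then have "full (\<not> u) (E u n) = 0" "full u (E u n) = 0"
          using full_low_degree[of 1 i "\<not> u"] full_X_power_P[OF i, of u] i
          unfolding E(1)[symmetric] E(2)[symmetric] by simp_all
        then show ?thesis by simp
      qed
    qed
  qed
  obtain c where c: "\<forall>n<2 * m. c n \<in> RW" "f = (\<Sum>n<2 * m. c n * E u n)"
    using expand_E by blast
  show ?thesis
    unfolding c(2) full_sum using c(1) E by (intro sum.cong) (auto simp: full_scale)
qed

lemma tr_head: "tr u f \<in> Ru (letter u (m - 2))"
proof -
  have "m - 1 = Suc (m - 2)" using m_ge_2 by simp
  then show ?thesis
    unfolding tr_def by (simp add: alt_snoc D_in_Ru del: alt.simps)
qed

text \<open>The two orders of operators end in different letters, so their common value is invariant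
  under both.\<close>

lemma full_in_RW: "full u f \<in> RW"
proof -
  have "full u f \<in> Ru (letter u (m - 2))" "full u f \<in> Ru (letter (\<not> u) (m - 2))"
    using tr_head[of u "D u f"] tr_head[of "\<not> u" "D (\<not> u) f"] braid[of u f] by (simp_all add: full_def)
  moreover have "letter (\<not> u) (m - 2) = (\<not> letter u (m - 2))"
    by (simp add: letter_def)
  ultimately show ?thesis
    unfolding RW_iff[of _ "letter u (m - 2)"] by (simp add: Rinv_iff)
qed

text \<open>\<open>P u\<close> has Demazure derivative 1, so multiplication by it lifts R^u back to
  R; thereby \<open>tr u\<close> inherits values in R^W.\<close>

lemma tr_eq_full: "y \<in> Ru u \<Longrightarrow> tr u y = full u (y * P u)"
  by (simp add: full_def D_linear D_P_self)

lemma rev_alt: "rev (alt b n) = alt (if odd n then b else \<not> b) n"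
proof (induction n arbitrary: b)
  case (Suc n)
  define c where "c = (if odd n then \<not> b else b)"
  have "rev (alt b (Suc n)) = alt c n @ [b]"
    using Suc[of "\<not> b"] by (auto simp: c_def)
  also have "\<dots> = alt c (Suc n)"
    using alt_snoc[of "\<not> c" n] by (auto simp: c_def letter_def)
  finally show ?case by (auto simp: c_def)
qed simp

lemma full_eq_dem_comp: "full u f = dem_comp Rz (rev (alt u m)) f"
proof -
  have "m = Suc (m - 1)" using m_ge_2 by simp
  then have "alt u m = u # alt (\<not> u) (m - 1)" by (metis alt.simps(2))
  then show ?thesis by (simp add: full_def tr_def dem_comp_append)
qed

lemma full_eq_dW: "full u f = dW Rz m f"
proof -
  have "full v f = full u f" for v
    using braid[of u f] by (cases "v = u") auto
  \<comment> \<open>For the letter \<open>odd m\<close> the reversed word starts with s, as in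
    \<open>dW\<close>.\<close>
  from this[of "odd m"] show ?thesis
    by (simp add: full_eq_dem_comp[of "odd m"] rev_alt dW_def split: if_splits)
qed

lemma tr_eq_dsW: "tr True = dsW Rz m" and tr_eq_dtW: "tr False = dtW Rz m"
  by (simp_all add: tr_def dsW_def dtW_def)

section \<open>Explicit dual bases\<close>

lemma trace_ext_D: "trace_ext (Ru u) UNIV (D u)"
  by (unfold_locales) (auto simp: subring_Rinv subring_UNIV D_in_Ru D_add D_linear)

lemma trace_ext_tr: "trace_ext RW (Ru u) (tr u)"
  using RW_subset_Ru[of u]
  by (unfold_locales) (auto simp: subring_Rinv tr_eq_full full_in_RW tr_RW_linear)

lemma trace_ext_full: "trace_ext RW UNIV (full u)"
  by (unfold_locales) (auto simp: subring_Rinv subring_UNIV full_in_RW full_linear)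

lemma D_eq_0_iff: "D u f = 0 \<longleftrightarrow> f \<in> Ru u"
  using alpha_D[of u f] D_inv by (auto simp: Rinv_iff)

text \<open>The product of \<open>P u\<close> and \<open>S u (P u)\<close> is
  \<open>u\<close>-invariant, so its derivative vanishes. The families are written by parity so that
  they fit the odd and even indices of \<open>E\<close> and stay homogeneous at every index.\<close>

lemma dual_bases_D:
  "dual_bases (Ru u) UNIV (D u) 2 (\<lambda>i. if even i then 1 else P u) (\<lambda>i. if even i then - S u (P u) else 1)"
proof -
  interpret trace_ext "Ru u" UNIV "D u" by (rule trace_ext_D)
  have SP: "S u (P u) * P u \<in> Ru u"
    by (simp add: Rinv_iff ract_mult S_S mult.commute)
  have "D u (S u (P u)) = - 1"
    by (rule D_eqI) (simp only: S_S, simp add: S_P_self)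
  then have D: "D u (- S u (P u)) = 1" "D u (P u * - S u (P u)) = 0" "D u 1 = 0"
    using D_linear[OF mconst_in_Rinv[of "- 1"], of u "S u (P u)"] D_inv[OF SP]
      D_linear[OF mconst_in_Rinv[of "- 1"], of u "S u (P u) * P u"] D_inv[OF subring_1[OF subring_Rinv]]
    by (simp_all add: mconst_minus mult.commute)
  show ?thesis
  proof (rule dual_basesI(1))
    show "D u ((if even i then 1 else P u) * (if even j then - S u (P u) else 1)) = (if i = j then 1 else 0)"
      if "i < 2" "j < 2" for i j :: nat
      using that D D_P_self[of u] by (auto simp: less_2_cases_iff)
    fix y :: "('n, 'k) mpoly"
    have "D u (y - D u y * P u) = D u y + mconst (- 1) * D u (D u y * P u)"
      using D_add[of u y "mconst (- 1) * (D u y * P u)"] D_linear[OF mconst_in_Rinv, of u "- 1" "D u y * P u"]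
      by (simp add: mconst_minus)
    then have "D u (y - D u y * P u) = 0"
      by (simp add: D_linear[OF D_in_Ru] D_P_self mconst_minus)
    then have "y - D u y * P u \<in> Ru u" by (simp add: D_eq_0_iff)
    then show "\<exists>a. (\<forall>i<2. a i \<in> Ru u) \<and> y = (\<Sum>i<2::nat. a i * (if even i then 1 else P u))"
      by (intro exI[of _ "\<lambda>i. if i = 0 then y - D u y * P u else D u y"])
        (auto simp: D_in_Ru numeral_2_eq_2)
  qed auto
qed

lemma qn_prod_unit: "k < m \<Longrightarrow> (\<Prod>j=1..k. qn q j) dvd 1"
proof (induction k)
  case (Suc k)
  then show ?case
    using mult_dvd_mono[of "\<Prod>j=1..k. qn q j" 1 "qn q (Suc k)" 1] qn_unit[of "Suc k"] by simp
qed simp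

definition qfact_inv :: "('n, 'k) mpoly" where
  "qfact_inv = mconst (SOME e. (\<Prod>j=1..m-1. qn q j) * e = 1)"

lemma qfact_inv: "qfact * qfact_inv = 1"
proof -
  have "\<exists>e. (\<Prod>j=1..m-1. qn q j) * e = 1"
    using qn_prod_unit[of "m - 1"] m_ge_2 by (metis One_nat_def diff_less dvdE less_le_trans pos2 zero_less_one)
  then have "(\<Prod>j=1..m-1. qn q j) * (SOME e. (\<Prod>j=1..m-1. qn q j) * e = 1) = 1"
    by (rule someI_ex)
  then show ?thesis
    unfolding qfact_def qfact_inv_def mconst_mult[symmetric] by simp
qed

text \<open>The coefficients of F / (T - X 0), as in Euler's formula for the dual of a power basis,
  divided by the trace [m-1]! of the constant one.\<close>

definition E_dual :: "bool \<Rightarrow> nat \<Rightarrow> ('n, 'k) mpoly" where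
  "E_dual u i = qfact_inv * coeff (G u (Suc 0)) i"

lemma qfact_inv_in: "qfact_inv \<in> Rinv Rz J"
  by (simp add: qfact_inv_def mconst_in_Rinv)

lemma E_dual_in_Ru: "E_dual u i \<in> Ru u"
  unfolding E_dual_def
  using coeff_G_1_in_Ru by (intro subring_mult[OF subring_Rinv] qfact_inv_in) simp

lemma tr_E_dual: "i < m \<Longrightarrow> j < m \<Longrightarrow> tr u (X u 0 ^ i * E_dual u j) = (if i = j then 1 else 0)"
proof -
  assume "i < m" "j < m"
  moreover have "X u 0 ^ i * E_dual u j = qfact_inv * (X u 0 ^ i * coeff (G u (Suc 0)) j)"
    by (simp add: E_dual_def mult_ac)
  ultimately show ?thesis
    using qfact_inv by (simp add: tr_scale qfact_inv_in tr_dual mult.commute)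
qed

text \<open>Spanning is inherited from R: an invariant \<open>y\<close> equals
  \<open>D u (y * P u)\<close>, and \<open>D u\<close> kills the even members of \<open>E u\<close>
  while stripping \<open>P u\<close> from the odd ones.\<close>

lemma dual_bases_tr: "dual_bases RW (Ru u) (tr u) m (\<lambda>i. X u 0 ^ i) (E_dual u)"
proof -
  interpret trace_ext RW "Ru u" "tr u" by (rule trace_ext_tr)
  show ?thesis
  proof (rule dual_basesI(1))
    fix y assume y: "y \<in> Ru u"
    obtain c where c: "\<forall>n<2 * m. c n \<in> RW" "y * P u = (\<Sum>n<2 * m. c n * E u n)"
      using expand_E by blast
    have "y = D u (y * P u)"
      using y by (simp add: D_linear D_P_self)
    also have "\<dots> = (\<Sum>n<2 * m. c n * D u (E u n))"
      unfolding c(2) D_sum using c(1) by (intro sum.cong) (auto simp: D_RW_linear)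
    also have "\<dots> = (\<Sum>i<m. c (Suc (2 * i)) * X u 0 ^ i)"
      unfolding sum_pairs E_def
      by (intro sum.cong) (auto simp: D_inv D_linear X_0_power_in_Ru D_P_self)
    finally show "\<exists>a. (\<forall>i<m. a i \<in> RW) \<and> y = (\<Sum>i<m. a i * X u 0 ^ i)"
      using c(1) by (intro exI[of _ "\<lambda>i. c (Suc (2 * i))"]) auto
  qed (use tr_E_dual E_dual_in_Ru X_0_power_in_Ru in auto)
qed

text \<open>Products of the dual bases along the tower R^W, R^u, R.\<close>

definition F_dual :: "bool \<Rightarrow> nat \<Rightarrow> ('n, 'k) mpoly" where
  "F_dual u n = E_dual u (n div 2) * (if even n then - S u (P u) else 1)"

text \<open>\<open>D u\<close> evaluates the parity factors and leaves an element of R^u, to which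
  \<open>tr_E_dual\<close> applies.\<close>

lemma dual_bases_full: "dual_bases RW UNIV (full u) (2 * m) (E u) (F_dual u)"
proof -
  interpret trace_ext RW UNIV "full u" by (rule trace_ext_full)
  show ?thesis
  proof (rule dual_basesI(1))
    fix i j assume ij: "i < 2 * m" "j < 2 * m"
    define e where "e = (\<lambda>i::nat. if even i then 1 else P u)"
    define e' where "e' = (\<lambda>i::nat. if even i then - S u (P u) else 1)"
    have db: "D u (e (a mod 2) * e' (b mod 2)) = (if a mod 2 = b mod 2 then 1 else 0)" for a b
      using dual_bases_D[of u] unfolding dual_bases_def e_def e'_def by (metis mod_less_divisor pos2)
    have mod: "e (a mod 2) = e a" "e' (a mod 2) = e' a" for a
      by (simp_all add: e_def e'_def)
    have "X u 0 ^ (i div 2) * E_dual u (j div 2) \<in> Ru u"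
      by (intro subring_mult[OF subring_Rinv] X_0_power_in_Ru E_dual_in_Ru)
    moreover have "E u i * F_dual u j = X u 0 ^ (i div 2) * E_dual u (j div 2) * (e i * e' j)"
      by (simp add: E_def F_dual_def e_def e'_def mult_ac)
    ultimately have D: "D u (E u i * F_dual u j) = X u 0 ^ (i div 2) * E_dual u (j div 2) * (if i mod 2 = j mod 2 then 1 else 0)"
      using db[of i j] by (simp add: D_linear mod)
    have "full u (E u i * F_dual u j) = (if i div 2 = j div 2 \<and> i mod 2 = j mod 2 then 1 else 0)"
      using ij tr_E_dual[of "i div 2" "j div 2" u] unfolding full_def D by auto
    also have "i div 2 = j div 2 \<and> i mod 2 = j mod 2 \<longleftrightarrow> i = j"
      by (metis div_mult_mod_eq)
    finally show "full u (E u i * F_dual u j) = (if i = j then 1 else 0)" .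
  next
    show "\<exists>a. (\<forall>i<2 * m. a i \<in> RW) \<and> y = (\<Sum>i<2 * m. a i * E u i)" for y
      by (rule expand_E)
  qed auto
qed

section \<open>Degrees\<close>

lemma homog_dem_comp: "homog f d \<Longrightarrow> homog (dem_comp Rz w f) (d - 2 * int (length w))"
proof (induction w)
  case (Cons b w)
  then show ?case using homog_D[of "dem_comp Rz w f" "d - 2 * int (length w)" b] by (simp add: algebra_simps)
qed simp

lemma homog_tr: "homog f d \<Longrightarrow> homog (tr u f) (d - 2 * (int m - 1))"
  unfolding tr_def using homog_dem_comp[of f d "rev (alt (\<not> u) (m - 1))"] m_ge_2 by (simp add: of_nat_diff)

lemma homog_X_0_power: "homog (X u 0 ^ i) (2 * int i)"
  using homog_power[OF homog_X] by (simp add: mult.commute)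

lemma homog_E: "homog (E u n) (2 * (int (n div 2) + int (n mod 2)))"
proof (cases "even n")
  case True
  then show ?thesis by (simp add: E_def homog_X_0_power even_iff_mod_2_eq_zero)
next
  case False
  then show ?thesis
    using homog_mult[OF homog_X_0_power homog_lin, of u "n div 2" "weight u"]
    by (auto simp: E_def algebra_simps odd_iff_mod_2_eq_one)
qed

lemma homog_E_dual: "homog (E_dual u i) (2 * (int m - 1 - int i))"
  unfolding E_dual_def qfact_inv_def
  using homog_mult[OF homog_mconst homog_coeff_G_1[of u i]] by simp

lemma graded_frob_extI:
  assumes "trace_ext A B t" and "dual_bases A B t r f g"
    and "\<And>y d. y \<in> B \<Longrightarrow> homog y d \<Longrightarrow> homog (t y) (d - l)"
    and "\<And>i. homog (f i) (df i)" "\<And>i. homog (g i) (dg i)"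
  shows "graded_frob_ext A B t"
  unfolding graded_frob_ext_def frob_ext_def
  using assms trace_ext.A_subset_B[OF assms(1)] trace_ext.tr_in[OF assms(1)] trace_ext.tr_linear[OF assms(1)]
  by blast

lemma graded_frob_ext_D: "graded_frob_ext (Ru u) UNIV (D u)"
proof (rule graded_frob_extI[OF trace_ext_D dual_bases_D])
  show "homog (if even i then 1 else P u) (if even i then 0 else 2)" for i :: nat
    by (simp add: homog_1 homog_lin)
  show "homog (if even i then - S u (P u) else 1) (if even i then 2 else 0)" for i :: nat
    by (simp add: homog_1 ract_lin homog_lin homog_minus)
qed (rule homog_D)

lemma graded_frob_ext_tr: "graded_frob_ext RW (Ru u) (tr u)"
  by (rule graded_frob_extI[OF trace_ext_tr dual_bases_tr homog_tr homog_X_0_power homog_E_dual])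

lemma frob_square_dihedral:
  "frob_square RW (Ru True) (Ru False) UNIV (D True) (D False) (dsW Rz m) (dtW Rz m) (dW Rz m)"
  unfolding frob_square_def
  using graded_frob_ext_D graded_frob_ext_tr[of True] graded_frob_ext_tr[of False]
    full_eq_dW[of True] full_eq_dW[of False]
  by (simp add: tr_eq_dsW tr_eq_dtW full_def)

lemma free_graded_R: "free_graded RW UNIV (2 * m) (E u) (\<lambda>n. 2 * (int (n div 2) + int (n mod 2)))"
  using dual_bases_full[of u] homog_E by (simp add: free_graded_def dual_bases_def)

lemma free_graded_Ru: "free_graded RW (Ru u) m (\<lambda>i. X u 0 ^ i) (\<lambda>i. 2 * int i)"
  using dual_bases_tr[of u] homog_X_0_power by (simp add: free_graded_def dual_bases_def)

section \<open>The product of the positive roots\<close>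

lemma qn_add: "qn q (Suc (a + b)) = qn q (Suc a) * qn q (Suc b) - qn q a * qn q b"
proof (induction a arbitrary: b)
  case (Suc a)
  show ?case using Suc[of "Suc b"] by (simp add: algebra_simps)
qed simp

text \<open>The three-term recurrence is the same in both directions, and [m] = 0, [m-1] = 1 repeat
  the initial values.\<close>

lemma qn_reflect: "j \<le> m \<Longrightarrow> qn q (m - j) = qn q j"
proof (induction j rule: less_induct)
  case (less j)
  consider "j = 0" | "j = 1" | k where "j = k + 2"
    by (metis One_nat_def add_2_eq_Suc' not0_implies_Suc)
  then show ?case
  proof cases
    case 1
    then show ?thesis by (simp add: qn_m)
  next
    case 2
    then show ?thesis using qn_m_minus_1 by simp
  next
    case 3
    define n where "n = m - j"
    have n: "m - Suc k = Suc n" "m - k = Suc (Suc n)"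
      using less.prems 3 by (auto simp: n_def)
    have "qn q (m - Suc k) = qn q (Suc k)" "qn q (m - k) = qn q k"
      using less.IH[of "Suc k"] less.IH[of k] less.prems 3 by auto
    from this[unfolded n] show ?thesis
      unfolding n_def[symmetric] by (simp add: 3 algebra_simps)
  qed
qed

text \<open>By reflection the quantum binomials of m - 1 all equal 1.\<close>

lemma qn_prod_split:
  "a \<le> m - 1 \<Longrightarrow> (\<Prod>j=1..m-1. qn q j) = (\<Prod>j=1..a. qn q j) * (\<Prod>j=1..m-1-a. qn q j)"
proof (induction a)
  case (Suc a)
  then have "m - 1 - a = Suc (m - 1 - Suc a)" "Suc (m - 1 - Suc a) = m - Suc a" by auto
  then have "(\<Prod>j=1..m-1-a. qn q j) = qn q (m - Suc a) * (\<Prod>j=1..m-1-Suc a. qn q j)"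
    by (metis (no_types, lifting) mult.commute prod.nat_ivl_Suc' le_add1 plus_1_eq_Suc)
  then show ?case
    using Suc qn_reflect[of "Suc a"] by (simp add: mult_ac)
qed simp

text \<open>The two positive roots \<open>f\<^bsub>s,l\<^esub>\<close> and \<open>f\<^bsub>t,l\<^esub>\<close>, ordered by which of the two simple roots
  has the larger quantum coefficient instead of by the starting letter.\<close>
definition rootA :: "bool \<Rightarrow> nat \<Rightarrow> ('n, 'k) mpoly" where
  "rootA u l = mconst (qn q (Suc l)) * \<alpha> (\<not> u) + mconst (qn q l) * \<alpha> u"

definition rootB :: "bool \<Rightarrow> nat \<Rightarrow> ('n, 'k) mpoly" where
  "rootB u l = mconst (qn q l) * \<alpha> (\<not> u) + mconst (qn q (Suc l)) * \<alpha> u"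

text \<open>Telescoping along the path. The two formulas feed each other, so they are proved in one
  induction.\<close>

lemma X_0_diff:
  "X u 0 - X u (2 * l) = mconst (qn q l) * rootB u l"
  "X u 0 - X u (Suc (2 * l)) = mconst (qn q (Suc l)) * rootA u l"
proof -
  have "X u 0 - X u (2 * l) = mconst (qn q l) * rootB u l \<and>
    X u 0 - X u (Suc (2 * l)) = mconst (qn q (Suc l)) * rootA u l"
  proof (induction l)
    case 0
    then show ?case using X_Suc[of u 0] by (simp add: rootA_def)
  next
    case (Suc l)
    have l: "letter u (Suc (2 * l)) = u" "letter u (Suc (Suc (2 * l))) = (\<not> u)"
      by (simp_all add: letter_def)
    \<comment> \<open>The addition formula splits [2l+2] and [2l+3] so that [l+1] and [l+2],
      respectively, factor out of the sums below.\<close>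
    have q: "qn q (Suc (Suc (2 * l))) = qn q (Suc (Suc l)) * qn q (Suc l) - qn q (Suc l) * qn q l"
      "qn q (Suc (Suc (Suc (2 * l)))) = qn q (Suc (Suc l)) * qn q (Suc (Suc l)) - qn q (Suc l) * qn q (Suc l)"
      using qn_add[of "Suc l" l] qn_add[of "Suc l" "Suc l"] by (simp_all add: mult_2 del: qn.simps)
    have "X u 0 - X u (2 * Suc l) = (X u 0 - X u (Suc (2 * l))) + (X u (Suc (2 * l)) - X u (Suc (Suc (2 * l))))"
      by simp
    also have "\<dots> = mconst (qn q (Suc l)) * rootA u l + mconst (qn q (Suc (Suc (2 * l)))) * \<alpha> u"
      using Suc.IH by (simp only: X_Suc l)
    also have "\<dots> = mconst (qn q (Suc l)) * rootB u (Suc l)"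
      unfolding q rootA_def rootB_def mconst_diff mconst_mult by (simp add: algebra_simps del: qn.simps)
    finally have 1: "X u 0 - X u (2 * Suc l) = mconst (qn q (Suc l)) * rootB u (Suc l)" .
    have "X u 0 - X u (Suc (2 * Suc l)) = (X u 0 - X u (2 * Suc l)) + (X u (Suc (Suc (2 * l))) - X u (Suc (Suc (Suc (2 * l)))))"
      by simp
    also have "\<dots> = mconst (qn q (Suc l)) * rootB u (Suc l) + mconst (qn q (Suc (Suc (Suc (2 * l))))) * \<alpha> (\<not> u)"
      by (simp only: X_Suc l 1)
    also have "\<dots> = mconst (qn q (Suc (Suc l))) * rootA u (Suc l)"
      unfolding q rootA_def rootB_def mconst_diff mconst_mult by (simp add: algebra_simps del: qn.simps)
    finally show ?case using 1 by simp
  qed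
  then show "X u 0 - X u (2 * l) = mconst (qn q l) * rootB u l"
    "X u 0 - X u (Suc (2 * l)) = mconst (qn q (Suc l)) * rootA u l" by simp_all
qed

lemma hdword_r_append: "hdword_r Rz (v @ w) \<xi> = hdword_r Rz w (hdword_r Rz v \<xi>)"
  by (induction v arbitrary: \<xi>) simp_all

lemma S_alpha_other: "S u (\<alpha> (\<not> u)) = \<alpha> (\<not> u) + mconst q * \<alpha> u"
  by (simp add: ract_lin lin_hdact pair_coroot_root_other mconst_minus)

lemma froot_Suc: "froot Rz u (Suc k) = S (letter u k) (froot Rz u k)"
  by (simp add: froot_def alt_snoc hdword_r_append ract_lin del: alt.simps)

lemma froot_eq:
  "froot Rz u k = mconst (qn q (Suc k)) * \<alpha> (\<not> letter u k) + mconst (qn q k) * \<alpha> (letter u k)"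
proof (induction k)
  case 0
  then show ?case by (simp add: froot_def)
next
  case (Suc k)
  have "froot Rz u (Suc k) = mconst (qn q (Suc k)) * (\<alpha> (\<not> letter u k) + mconst q * \<alpha> (letter u k)) -
      mconst (qn q k) * \<alpha> (letter u k)"
    unfolding froot_Suc Suc ract_add ract_mult ract_mconst S_alpha_other S_alpha_self by simp
  then show ?case
    by (simp add: letter_Suc mconst_diff mconst_mult algebra_simps)
qed

lemma froot_self: "froot Rz u l = (if even l then rootB u l else rootA u l)"
  and froot_other: "froot Rz (\<not> u) l = (if even l then rootA u l else rootB u l)"
  by (simp_all add: froot_eq letter_def rootA_def rootB_def add.commute)

lemma rootA_rootB: "rootA True l * rootB True l = froot Rz True l * froot Rz False l"
  using froot_self[of True l] froot_other[of True l] by (simp add: mult.commute)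

text \<open>The factors with indices 2l and 2l + 1 contribute the two roots of level l. The simple
  root in front is \<open>rootB u 0\<close>, which the missing factor at index 0 leaves out.\<close>

lemma alpha_prod_X_diff_even:
  "\<alpha> u * (\<Prod>j\<in>{1..<2 * Suc k}. X u 0 - X u j) =
    mconst ((\<Prod>j=1..Suc k. qn q j) * (\<Prod>j=1..k. qn q j)) * (\<Prod>l<Suc k. rootA u l * rootB u l)"
proof (induction k)
  case 0
  have "{1..<2 * Suc 0} = {Suc (2 * 0)}" by auto
  then show ?case by (simp only: X_0_diff prod.insert finite.emptyI) (simp add: X_0_diff(2)[of _ 0, simplified] rootB_def mult.commute)
next
  case (Suc k)
  have "{1..<2 * Suc (Suc k)} = insert (2 * Suc k) (insert (Suc (2 * Suc k)) {1..<2 * Suc k})"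
    by auto
  then have "(\<Prod>j\<in>{1..<2 * Suc (Suc k)}. X u 0 - X u j) =
      (mconst (qn q (Suc k)) * rootB u (Suc k)) * ((mconst (qn q (Suc (Suc k))) * rootA u (Suc k)) * (\<Prod>j\<in>{1..<2 * Suc k}. X u 0 - X u j))"
    by (simp only: prod.insert finite_insert finite_atLeastLessThan X_0_diff[symmetric]) simp
  then have "\<alpha> u * (\<Prod>j\<in>{1..<2 * Suc (Suc k)}. X u 0 - X u j) =
      (mconst (qn q (Suc k)) * mconst (qn q (Suc (Suc k)))) * (rootA u (Suc k) * rootB u (Suc k)) *
      (\<alpha> u * (\<Prod>j\<in>{1..<2 * Suc k}. X u 0 - X u j))"
    by (simp add: mult_ac del: qn.simps)
  then show ?case
    unfolding Suc by (simp add: mconst_mult mult_ac del: qn.simps)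
qed

text \<open>For odd m the root f_(s, m-1-l) is f_(t, l), by reflection of the quantum numbers.
  Folding the second half of the product brings it to the shape of the even case with one middle
  root left over.\<close>

lemma Lambda_odd:
  assumes "m = Suc (2 * k)"
  shows "Lambda Rz m = (\<Prod>l<k. froot Rz True l * froot Rz False l) * rootB True k"
proof -
  have refl: "froot Rz True (m - 1 - l) = froot Rz False l" if "l \<le> m - 1" for l
  proof -
    have "qn q (m - 1 - l) = qn q (Suc l)" "qn q (Suc (m - 1 - l)) = qn q l"
      using qn_reflect[of "Suc l"] qn_reflect[of l] that m_ge_2 by (simp_all add: Suc_diff_le Suc_diff_Suc del: qn.simps)
    moreover have "even (m - 1 - l) = even l" using assms that by auto
    ultimately show ?thesis
      by (simp add: froot_eq letter_def add.commute del: qn.simps)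
  qed
  have "(\<Prod>l<m. froot Rz True l) = (\<Prod>l<Suc k. froot Rz True l) * (\<Prod>l=Suc k..<m. froot Rz True l)"
    using assms by (subst prod.atLeastLessThan_concat[of 0 "Suc k" m, symmetric, unfolded atLeast0LessThan]) auto
  also have "(\<Prod>l=Suc k..<m. froot Rz True l) = (\<Prod>l<k. froot Rz True (m - 1 - l))"
    by (rule prod.reindex_bij_witness[of _ "\<lambda>l. m - 1 - l" "\<lambda>l. m - 1 - l"]) (use assms in auto)
  also have "\<dots> = (\<Prod>l<k. froot Rz False l)"
    using assms by (intro prod.cong refl) auto
  also have "(\<Prod>l<Suc k. froot Rz True l) = (\<Prod>l<k. froot Rz True l) * froot Rz True k"
    by simp
  \<comment> \<open>As k = m - 1 - k, the middle root is its own mirror image; this turns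
    \<open>rootA\<close> into \<open>rootB\<close> when k is odd.\<close>
  also have "froot Rz True k = rootB True k"
    using froot_self[of True k] froot_other[of True k] refl[of k] assms by (cases "even k") auto
  finally show ?thesis
    using assms by (simp add: Lambda_def prod.distrib mult_ac)
qed

lemma alpha_prod_X_diff:
  "\<alpha> True * (\<Prod>j\<in>{1..<m}. X True 0 - X True j) = qfact * Lambda Rz m"
proof -
  \<comment> \<open>The shift matches the bound \<open>2 * Suc k\<close> of the even case, which
    starts with a non-empty product.\<close>
  define k where "k = m div 2 - 1"
  have "m = 2 * Suc k \<or> m = Suc (2 * Suc k)"
    using m_ge_2 unfolding k_def by presburger
  then show ?thesis
  proof
    assume m: "m = 2 * Suc k"
    have "qfact = mconst ((\<Prod>j=1..Suc k. qn q j) * (\<Prod>j=1..k. qn q j))"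
      unfolding qfact_def using qn_prod_split[of "Suc k"] m by simp
    moreover have "Lambda Rz m = (\<Prod>l<Suc k. rootA True l * rootB True l)"
      by (simp add: Lambda_def m rootA_rootB)
    ultimately show ?thesis
      using alpha_prod_X_diff_even[of True k, folded m] by simp
  next
    assume m: "m = Suc (2 * Suc k)"
    have "qfact = mconst ((\<Prod>j=1..Suc k. qn q j) * (\<Prod>j=1..Suc k. qn q j))"
      unfolding qfact_def using qn_prod_split[of "Suc k"] m by simp
    moreover have "Lambda Rz m = (\<Prod>l<Suc k. rootA True l * rootB True l) * rootB True (Suc k)"
      unfolding Lambda_odd[OF m] rootA_rootB ..
    moreover have "{1..<m} = insert (2 * Suc k) {1..<2 * Suc k}" using m by auto
    then have "(\<Prod>j\<in>{1..<m}. X True 0 - X True j) =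
        (mconst (qn q (Suc k)) * rootB True (Suc k)) * (\<Prod>j\<in>{1..<2 * Suc k}. X True 0 - X True j)"
      by (simp only: prod.insert finite_atLeastLessThan X_0_diff[symmetric]) simp
    then have "\<alpha> True * (\<Prod>j\<in>{1..<m}. X True 0 - X True j) =
        (mconst (qn q (Suc k)) * rootB True (Suc k)) * (\<alpha> True * (\<Prod>j\<in>{1..<2 * Suc k}. X True 0 - X True j))"
      by (simp add: mult_ac del: qn.simps)
    ultimately show ?thesis
      unfolding alpha_prod_X_diff_even by (simp add: mconst_mult mult_ac del: qn.simps)
  qed
qed

section \<open>Comultiplication elements\<close>

text \<open>A division-free form of the quotient of \<Lambda> by a simple root: G at X 0 is the
  derivative of F at X 0, scaled here by the inverse of [m-1]!.\<close>

definition Lambda_sub :: "bool \<Rightarrow> ('n, 'k) mpoly" where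
  "Lambda_sub u = qfact_inv * poly (G u (Suc 0)) (X u 0)"

lemma poly_G: "poly (G u k) x = (\<Prod>j\<in>{k..<m}. x - X u j)"
  by (simp add: G_def poly_prod)

lemma alpha_Lambda_sub: "\<alpha> True * Lambda_sub True = Lambda Rz m"
proof -
  have "\<alpha> True * Lambda_sub True = qfact_inv * (\<alpha> True * (\<Prod>j\<in>{1..<m}. X True 0 - X True j))"
    by (simp add: Lambda_sub_def poly_G mult_ac)
  also have "\<dots> = (qfact * qfact_inv) * Lambda Rz m"
    unfolding alpha_prod_X_diff by (simp add: mult_ac)
  finally show ?thesis by (simp add: qfact_inv)
qed

text \<open>Stated for arbitrary \<open>x\<close> since it is evaluated both at X 0 and at X
  1.\<close>

lemma sum_E_dual: "(\<Sum>i<m. x ^ i * E_dual u i) = qfact_inv * poly (G u (Suc 0)) x"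
  by (subst poly_as_sum[of m]) (auto simp: G_1_monic E_dual_def sum_distrib_left mult_ac)

text \<open>The two members sharing a power of \<open>X u 0\<close> combine to the factor
  \<open>P u - S u (P u)\<close>, which is the simple root.\<close>

lemma sum_F_dual: "(\<Sum>n<2 * m. E u n * F_dual u n) = \<alpha> u * Lambda_sub u"
proof -
  have "(\<Sum>n<2 * m. E u n * F_dual u n) = (\<Sum>i<m. X u 0 ^ i * E_dual u i * (P u - S u (P u)))"
    unfolding sum_pairs by (intro sum.cong refl) (simp add: E_def F_dual_def algebra_simps)
  also have "\<dots> = (\<Sum>i<m. X u 0 ^ i * E_dual u i) * (P u - S u (P u))"
    by (rule sum_distrib_right[symmetric])
  also have "\<dots> = \<alpha> u * Lambda_sub u"
    unfolding sum_E_dual Lambda_sub_def S_P_self by (simp add: mult.commute)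
  finally show ?thesis .
qed

lemma dual_bases_full_sum:
  assumes "dual_bases RW UNIV (full u) r f g"
  shows "(\<Sum>i<r. f i * g i) = \<alpha> u * Lambda_sub u"
  unfolding sum_F_dual[symmetric]
  by (rule trace_ext.dual_bases_independent[OF trace_ext_full _ _ _ assms dual_bases_full])
    (simp_all add: algebra_simps)

lemma full_Lambda: "full u (\<alpha> u * Lambda_sub u) = of_nat (2 * m)"
  unfolding sum_F_dual[symmetric]
  by (rule trace_ext.dual_bases_trace_sum[OF trace_ext_full dual_bases_full])

lemma dual_bases_tr_sum:
  assumes "dual_bases RW (Ru u) (tr u) r f g"
  shows "(\<Sum>i<r. f i * g i) = Lambda_sub u"
  unfolding Lambda_sub_def sum_E_dual[symmetric]
  by (rule trace_ext.dual_bases_independent[OF trace_ext_tr _ _ _ assms dual_bases_tr])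
    (simp_all add: algebra_simps)

lemma tr_Lambda_sub: "tr u (Lambda_sub u) = of_nat m"
  unfolding Lambda_sub_def sum_E_dual[symmetric]
  by (rule trace_ext.dual_bases_trace_sum[OF trace_ext_tr dual_bases_tr])

text \<open>On the explicit bases \<open>D (\<not> u)\<close> strips T - X 1 from G. At T = X 0 the
  missing factor X 0 - X 1 is the simple root \<open>\<alpha> (\<not> u)\<close>.\<close>

lemma dual_bases_tr_D_right:
  assumes "dual_bases RW (Ru u) (tr u) r f g"
  shows "\<alpha> (\<not> u) * (\<Sum>i<r. f i * D (\<not> u) (g i)) = Lambda_sub u"
proof -
  have D: "D (\<not> u) (E_dual u i) = qfact_inv * coeff (G u (Suc (Suc 0))) i" for i
    using D_coeff_G[of 0 u i] m_ge_2 by (simp add: E_dual_def D_linear qfact_inv_in)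
  have "(\<Sum>i<r. f i * D (\<not> u) (g i)) = (\<Sum>i<m. X u 0 ^ i * D (\<not> u) (E_dual u i))"
    by (rule trace_ext.dual_bases_independent[OF trace_ext_tr _ _ _ assms dual_bases_tr])
      (simp_all add: algebra_simps D_add D_RW_linear)
  also have "\<dots> = qfact_inv * poly (G u (Suc (Suc 0))) (X u 0)"
  proof -
    have "coeff (G u (Suc (Suc 0))) i = 0" if "m \<le> i" for i
      using prod_linear_monic[of "{2..<m}" "X u"] that m_ge_2 by (simp add: G_def numeral_2_eq_2)
    then show ?thesis
      by (subst poly_as_sum[of m]) (auto simp: D sum_distrib_left mult_ac)
  qed
  also have "\<alpha> (\<not> u) * \<dots> = qfact_inv * poly (G u (Suc 0)) (X u 0)"
    using m_ge_2 X_Suc[of u 0] by (simp add: G_step[of "Suc 0"] algebra_simps)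
  finally show ?thesis by (simp add: Lambda_sub_def)
qed

text \<open>\<open>D (\<not> u)\<close> turns powers of X 0 into difference quotients between X 0
  and X 1, and G vanishes at X 1.\<close>

lemma dual_bases_tr_D_left:
  assumes "dual_bases RW (Ru u) (tr u) r f g"
  shows "\<alpha> (\<not> u) * (\<Sum>i<r. D (\<not> u) (f i) * g i) = Lambda_sub u"
proof -
  have "(\<Sum>i<r. D (\<not> u) (f i) * g i) = (\<Sum>i<m. D (\<not> u) (X u 0 ^ i) * E_dual u i)"
    by (rule trace_ext.dual_bases_independent[OF trace_ext_tr _ _ _ assms dual_bases_tr])
      (simp_all add: algebra_simps D_add D_RW_linear)
  also have "\<alpha> (\<not> u) * \<dots> = (\<Sum>i<m. (X u 0 ^ i - X u 1 ^ i) * E_dual u i)"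
    using S_letter_X[of u 0]
    by (simp add: sum_distrib_left mult.assoc[symmetric] alpha_D ract_power)
  also have "\<dots> = qfact_inv * poly (G u (Suc 0)) (X u 0) - qfact_inv * poly (G u (Suc 0)) (X u 1)"
    by (simp add: left_diff_distrib sum_subtractf sum_E_dual)
  also have "poly (G u (Suc 0)) (X u 1) = 0"
    using m_ge_2 by (simp add: G_step[of "Suc 0"])
  finally show ?thesis by (simp add: Lambda_sub_def)
qed

lemma pdiv_Lambda_alpha: "pdiv (Lambda Rz m) (\<alpha> True) = Lambda_sub True"
  by (rule pdiv_eqI) (use alpha_nonzero_divisor alpha_Lambda_sub in blast)+

lemma pdiv_Lambda_alpha_alpha:
  assumes "\<alpha> False * z = Lambda_sub True"
  shows "pdiv (Lambda Rz m) (\<alpha> True * \<alpha> False) = z"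
proof (rule pdiv_eqI)
  show "p = 0" if "\<alpha> True * \<alpha> False * p = 0" for p
    using alpha_nonzero_divisor[of False p] alpha_nonzero_divisor[of True "\<alpha> False * p"] that
    by (simp add: mult.assoc)
  show "\<alpha> True * \<alpha> False * z = Lambda Rz m"
    by (simp add: mult.assoc assms alpha_Lambda_sub)
qed

end

section \<open>Tensor products\<close>

lemma fsum_append: "fsum (xs @ ys) = fsum xs + fsum ys"
  by (simp add: fsum_def)

lemma fsum_map: "fsum (map h [0..<r]) = (\<Sum>i<r. fsum [h i])"
  by (induction r) (simp_all add: fsum_def)

lemma trel_sum: "finite I \<Longrightarrow> (\<And>i. i \<in> I \<Longrightarrow> h i \<in> trel A B C) \<Longrightarrow> (\<Sum>i\<in>I. h i) \<in> trel A B C"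
  by (induction I rule: finite_induct) (auto intro: trel.zero trel.plus)

lemma trel_trans: "x - y \<in> trel A B C \<Longrightarrow> y - z \<in> trel A B C \<Longrightarrow> x - z \<in> trel A B C"
  using trel.plus[of "x - y" A B C "y - z"] by simp

lemma trel_sum_cong:
  assumes "finite I" "\<And>i. i \<in> I \<Longrightarrow> h i - h' i \<in> trel A B C"
  shows "(\<Sum>i\<in>I. h i) - (\<Sum>i\<in>I. h' i) \<in> trel A B C"
  unfolding sum_subtractf[symmetric] using assms by (rule trel_sum)

lemma trel_suml:
  assumes B: "subring_set B" and c: "c \<in> C"
  shows "finite I \<Longrightarrow> (\<And>i. i \<in> I \<Longrightarrow> h i \<in> B) \<Longrightarrow>
    fsum [(\<Sum>i\<in>I. h i, c)] - (\<Sum>i\<in>I. fsum [(h i, c)]) \<in> trel A B C"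
proof (induction I rule: finite_induct)
  case empty
  have "- fsum [(0, c)] \<in> trel A B C"
    using trel.addl[OF subring_0[OF B] subring_0[OF B] c, of A] by simp
  then show ?case using trel.neg by fastforce
next
  case (insert i I)
  have "fsum [(h i + (\<Sum>i\<in>I. h i), c)] - fsum [(h i, c)] - fsum [(\<Sum>i\<in>I. h i, c)] \<in> trel A B C"
    using insert c by (intro trel.addl subring_sum[OF B]) auto
  moreover have "fsum [(\<Sum>i\<in>I. h i, c)] - (\<Sum>i\<in>I. fsum [(h i, c)]) \<in> trel A B C"
    using insert by simp
  ultimately show ?case
    using insert(1,2) trel.plus by (fastforce simp: algebra_simps)
qed

lemma trel_sumr:
  assumes C: "subring_set C" and b: "b \<in> B"
  shows "finite I \<Longrightarrow> (\<And>i. i \<in> I \<Longrightarrow> h i \<in> C) \<Longrightarrow>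
    fsum [(b, \<Sum>i\<in>I. h i)] - (\<Sum>i\<in>I. fsum [(b, h i)]) \<in> trel A B C"
proof (induction I rule: finite_induct)
  case empty
  have "- fsum [(b, 0)] \<in> trel A B C"
    using trel.addr[OF b subring_0[OF C] subring_0[OF C], of A] by simp
  then show ?case using trel.neg by fastforce
next
  case (insert i I)
  have "fsum [(b, h i + (\<Sum>i\<in>I. h i))] - fsum [(b, h i)] - fsum [(b, \<Sum>i\<in>I. h i)] \<in> trel A B C"
    using insert b by (intro trel.addr subring_sum[OF C]) auto
  moreover have "fsum [(b, \<Sum>i\<in>I. h i)] - (\<Sum>i\<in>I. fsum [(b, h i)]) \<in> trel A B C"
    using insert by simp
  ultimately show ?case
    using insert(1,2) trel.plus by (fastforce simp: algebra_simps)
qed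

text \<open>Both sums expand to the same double sum of simple tensors once the scalars
  \<open>a i j\<close> cross the tensor sign. It is used wherever two expansions share one
  coefficient matrix.\<close>

lemma trel_exchange:
  fixes r r' :: nat
  assumes B: "subring_set B" and C: "subring_set C" and AB: "A \<subseteq> B" and AC: "A \<subseteq> C"
    and b: "\<And>i. i < r \<Longrightarrow> b i \<in> B" and c: "\<And>j. j < r' \<Longrightarrow> c j \<in> C"
    and a: "\<And>i j. i < r \<Longrightarrow> j < r' \<Longrightarrow> a i j \<in> A"
  shows "(\<Sum>i<r. fsum [(b i, \<Sum>j<r'. a i j * c j)]) - (\<Sum>j<r'. fsum [(\<Sum>i<r. b i * a i j, c j)]) \<in> trel A B C"
proof -
  have ac: "a i j * c j \<in> C" and ba: "b i * a i j \<in> B" if "i < r" "j < r'" for i j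
    using that a b c AB AC by (auto intro!: subring_mult[OF B] subring_mult[OF C])
  have 1: "(\<Sum>i<r. fsum [(b i, \<Sum>j<r'. a i j * c j)]) - (\<Sum>i<r. \<Sum>j<r'. fsum [(b i, a i j * c j)]) \<in> trel A B C"
    using ac b by (intro trel_sum_cong trel_sumr[OF C]) auto
  have "fsum [(b i, a i j * c j)] - fsum [(b i * a i j, c j)] \<in> trel A B C" if "i < r" "j < r'" for i j
    using trel.neg[OF trel.bal[OF a b c]] that by fastforce
  then have 2: "(\<Sum>i<r. \<Sum>j<r'. fsum [(b i, a i j * c j)]) - (\<Sum>i<r. \<Sum>j<r'. fsum [(b i * a i j, c j)]) \<in> trel A B C"
    by (intro trel_sum_cong) auto
  have "(\<Sum>j<r'. fsum [(\<Sum>i<r. b i * a i j, c j)]) - (\<Sum>j<r'. \<Sum>i<r. fsum [(b i * a i j, c j)]) \<in> trel A B C"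
    using ba c by (intro trel_sum_cong trel_suml[OF B]) auto
  then have "(\<Sum>i<r. \<Sum>j<r'. fsum [(b i * a i j, c j)]) - (\<Sum>j<r'. fsum [(\<Sum>i<r. b i * a i j, c j)]) \<in> trel A B C"
    by (subst sum.swap) (use trel.neg in fastforce)
  then show ?thesis
    using trel_trans[OF 1 trel_trans[OF 2]] by blast
qed

lemma teq_mapI:
  assumes "\<And>i. i < r \<Longrightarrow> b i \<in> B \<and> c i \<in> C" "\<And>j. j < r' \<Longrightarrow> b' j \<in> B \<and> c' j \<in> C"
    and "(\<Sum>i<r. fsum [(b i, c i)]) - (\<Sum>j<r'. fsum [(b' j, c' j)]) \<in> trel A B C"
  shows "teq A B C (map (\<lambda>i. (b i, c i)) [0..<r]) (map (\<lambda>j. (b' j, c' j)) [0..<r'])"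
  using assms by (auto simp: teq_def fsum_map)

section \<open>The exchange identity and the linearity of the induced map\<close>

context dihedral
begin

text \<open>Both sides have coefficient matrix \<open>full u (f * gs i * ft j)\<close> with respect
  to \<open>fs\<close> and \<open>gt\<close>. The left side computes it through
  R^(\<open>\<not> u\<close>), the right side through R^\<open>u\<close>, and \<open>braid\<close>
  says that the results agree.\<close>

lemma comult_exchange:
  assumes s: "dual_bases RW (Ru u) (tr u) rs fs gs"
    and t: "dual_bases RW (Ru (\<not> u)) (tr (\<not> u)) rt ft gt"
  shows "teq RW (Ru u) (Ru (\<not> u)) (map (\<lambda>i. (fs i, D (\<not> u) (f * gs i))) [0..<rs])
    (map (\<lambda>j. (D u (f * ft j), gt j)) [0..<rt])"
proof -
  interpret s: trace_ext RW "Ru u" "tr u" by (rule trace_ext_tr)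
  interpret t: trace_ext RW "Ru (\<not> u)" "tr (\<not> u)" by (rule trace_ext_tr)
  note in_s = s.dual_in_B[OF s] and in_t = t.dual_in_B[OF t]
  define a where "a = (\<lambda>i j. full u (f * gs i * ft j))"
  have L: "D (\<not> u) (f * gs i) = (\<Sum>j<rt. a i j * gt j)" if "i < rs" for i
  proof -
    have "tr (\<not> u) (D (\<not> u) (f * gs i) * ft j) = a i j" if "j < rt" for j
    proof -
      have "D (\<not> u) (f * gs i * ft j) = D (\<not> u) (f * gs i) * ft j"
        using D_linear[OF in_t(1)[OF that], of "f * gs i"] by (simp add: mult.commute)
      then have "tr (\<not> u) (D (\<not> u) (f * gs i) * ft j) = full (\<not> u) (f * gs i * ft j)"
        by (simp add: full_def)
      then show ?thesis by (simp add: a_def braid)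
    qed
    then show ?thesis
      using t.dual_expand(2)[OF t D_in_Ru, of "f * gs i"] by simp
  qed
  have R: "D u (f * ft j) = (\<Sum>i<rs. fs i * a i j)" if "j < rt" for j
  proof -
    have "tr u (D u (f * ft j) * gs i) = a i j" if "i < rs" for i
    proof -
      have "D u (f * gs i * ft j) = D u (f * ft j) * gs i"
        using D_linear[OF in_s(2)[OF that], of "f * ft j"] by (simp add: mult_ac)
      then show ?thesis by (simp add: a_def full_def)
    qed
    then show ?thesis
      using s.dual_expand(1)[OF s D_in_Ru, of "f * ft j"] by (simp add: mult.commute)
  qed
  have "(\<Sum>i<rs. fsum [(fs i, \<Sum>j<rt. a i j * gt j)]) -
      (\<Sum>j<rt. fsum [(\<Sum>i<rs. fs i * a i j, gt j)]) \<in> trel RW (Ru u) (Ru (\<not> u))"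
    using in_s in_t RW_subset_Ru by (intro trel_exchange subring_Rinv) (auto simp: a_def full_in_RW)
  then have "(\<Sum>i<rs. fsum [(fs i, D (\<not> u) (f * gs i))]) - (\<Sum>j<rt. fsum [(D u (f * ft j), gt j)])
      \<in> trel RW (Ru u) (Ru (\<not> u))"
    by (simp add: L R)
  then show ?thesis
    by (intro teq_mapI conjI in_s in_t D_in_Ru)
qed

lemma comult_add:
  assumes s: "dual_bases RW (Ru u) (tr u) rs fs gs"
  shows "teq RW (Ru u) (Ru v) (map (\<lambda>i. (fs i, D v ((f + f') * gs i))) [0..<rs])
    (map (\<lambda>i. (fs i, D v (f * gs i))) [0..<rs] @ map (\<lambda>i. (fs i, D v (f' * gs i))) [0..<rs])"
proof -
  note in_s = trace_ext.dual_in_B[OF trace_ext_tr s]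
  have "(\<Sum>i<rs. fsum [(fs i, D v (f * gs i) + D v (f' * gs i))] - fsum [(fs i, D v (f * gs i))] - fsum [(fs i, D v (f' * gs i))])
      \<in> trel RW (Ru u) (Ru v)"
    using in_s by (intro trel_sum trel.addr) (auto simp: D_in_Ru)
  then show ?thesis
    using in_s by (auto simp: teq_def D_in_Ru fsum_append fsum_map sum_subtractf sum.distrib
      distrib_right D_add diff_diff_eq intro: subring_add[OF subring_Rinv])
qed

text \<open>The comultiplication element is central: multiplication by \<open>a\<close> has the same
  matrix on \<open>gs\<close> as, transposed, on \<open>fs\<close>, so \<open>a\<close> moves from
  one tensor factor to the other.\<close>

lemma comult_left_linear:
  assumes s: "dual_bases RW (Ru u) (tr u) rs fs gs" and a: "a \<in> Ru u"
  shows "teq RW (Ru u) (Ru v) (map (\<lambda>i. (fs i, D v (a * f * gs i))) [0..<rs])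
    (map (\<lambda>i. (a * fs i, D v (f * gs i))) [0..<rs])"
proof -
  interpret s: trace_ext RW "Ru u" "tr u" by (rule trace_ext_tr)
  note in_s = s.dual_in_B[OF s]
  have in_a: "a * fs i \<in> Ru u" "a * gs i \<in> Ru u" if "i < rs" for i
    using in_s[OF that] a by (auto intro: subring_mult[OF subring_Rinv])
  define c where "c = (\<lambda>i j. tr u (a * gs i * fs j))"
  have c: "c i j \<in> RW" if "i < rs" "j < rs" for i j
    unfolding c_def using that by (intro s.tr_in subring_mult[OF subring_Rinv, of "a * gs i"] in_a in_s)
  have L: "D v (a * f * gs i) = (\<Sum>j<rs. c i j * D v (f * gs j))" if "i < rs" for i
  proof -
    have "a * gs i = (\<Sum>j<rs. c i j * gs j)"
      using s.dual_expand(2)[OF s in_a(2)[OF that]] by (simp only: c_def)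
    moreover have "a * f * gs i = f * (a * gs i)" by (simp add: mult_ac)
    ultimately have "D v (a * f * gs i) = D v (f * (\<Sum>j<rs. c i j * gs j))" by simp
    also have "\<dots> = (\<Sum>j<rs. D v (c i j * (f * gs j)))"
      by (simp add: sum_distrib_left D_sum mult_ac)
    also have "\<dots> = (\<Sum>j<rs. c i j * D v (f * gs j))"
      using c that by (intro sum.cong refl D_RW_linear) auto
    finally show ?thesis .
  qed
  have R: "a * fs j = (\<Sum>i<rs. fs i * c i j)" if "j < rs" for j
    using s.dual_expand(1)[OF s in_a(1)[OF that]] by (simp add: c_def mult_ac)
  have "(\<Sum>i<rs. fsum [(fs i, \<Sum>j<rs. c i j * D v (f * gs j))]) -
      (\<Sum>j<rs. fsum [(\<Sum>i<rs. fs i * c i j, D v (f * gs j))]) \<in> trel RW (Ru u) (Ru v)"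
    using in_s RW_subset_Ru c by (intro trel_exchange subring_Rinv) (auto simp: D_in_Ru)
  then have "(\<Sum>i<rs. fsum [(fs i, D v (a * f * gs i))]) - (\<Sum>j<rs. fsum [(a * fs j, D v (f * gs j))])
      \<in> trel RW (Ru u) (Ru v)"
    by (simp add: L R)
  then show ?thesis
    by (intro teq_mapI conjI in_s in_a D_in_Ru)
qed

lemma comult_right_linear:
  assumes s: "dual_bases RW (Ru u) (tr u) rs fs gs" and c: "c \<in> Ru v"
  shows "teq RW (Ru u) (Ru v) (map (\<lambda>i. (fs i, D v (f * c * gs i))) [0..<rs])
    (map (\<lambda>i. (fs i, D v (f * gs i) * c)) [0..<rs])"
proof -
  note in_s = trace_ext.dual_in_B[OF trace_ext_tr s]
  have "D v (f * c * gs i) = D v (f * gs i) * c" for i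
    using D_linear[OF c, of "f * gs i"] by (simp add: mult_ac)
  moreover have "D v (f * gs i) * c \<in> Ru v" for i
    using c by (intro subring_mult[OF subring_Rinv] D_in_Ru)
  ultimately show ?thesis
    using in_s by (intro teq_mapI) (auto intro: trel.zero)
qed

end

section \<open>The Weyl group and its length function\<close>

lemma hword_append: "hword Rz (v @ w) = hword Rz v \<circ> hword Rz w"
  by (induction v) auto

lemma alt_add: "alt b (k + l) = alt b k @ alt (if even k then b else \<not> b) l"
  by (induction k arbitrary: b) auto

context dihedral
begin

abbreviation aw :: "bool \<Rightarrow> nat \<Rightarrow> ('n \<Rightarrow> 'k) \<Rightarrow> ('n \<Rightarrow> 'k)" where
  "aw b n \<equiv> hword Rz (alt b n)"

lemma hact_involution: "hact Rz b \<circ> hact Rz b = id"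
  using realization by (cases b) (simp_all add: dihedral_realization_def)

lemma hact_neq_id: "hact Rz b \<noteq> id"
  using realization by (cases b) (simp_all add: dihedral_realization_def)

lemma hword_rev: "hword Rz (rev w) \<circ> hword Rz w = id" "hword Rz w \<circ> hword Rz (rev w) = id"
proof (induction w)
  case (Cons b w)
  have "hword Rz (rev (b # w)) \<circ> hword Rz (b # w) = hword Rz (rev w) \<circ> (hact Rz b \<circ> hact Rz b) \<circ> hword Rz w"
    by (simp add: hword_append comp_assoc)
  then show "hword Rz (rev (b # w)) \<circ> hword Rz (b # w) = id"
    by (simp only: hact_involution comp_id Cons)
  have "hword Rz (b # w) \<circ> hword Rz (rev (b # w)) = hact Rz b \<circ> (hword Rz w \<circ> hword Rz (rev w)) \<circ> hact Rz b"
    by (simp add: hword_append comp_assoc)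
  then show "hword Rz (b # w) \<circ> hword Rz (rev (b # w)) = id"
    by (simp only: hact_involution comp_id Cons)
qed simp_all

lemma hword_cancel: "hword Rz v \<circ> f = hword Rz v \<circ> g \<Longrightarrow> f = g"
  by (metis comp_assoc hword_rev(1) id_comp)

lemma aw_True_even: "aw True (2 * k) = (hact Rz True \<circ> hact Rz False) ^^ k"
  by (induction k) (simp_all add: comp_assoc)

text \<open>The word of length 2m for the m-th power of st splits into one alternating word of
  length m and the inverse of the other.\<close>

lemma aw_braid: "aw b m = aw (\<not> b) m"
proof -
  have "aw True m = aw False m"
  proof -
    have "(hact Rz True \<circ> hact Rz False) ^^ m = id"
      using realization by (simp add: dihedral_realization_def)
    then have "aw True (m + m) = id"
      using aw_True_even[of m] by (simp add: mult_2)
    moreover have alt: "alt (if even m then True else \<not> True) m = rev (alt False m)"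
      by (simp add: rev_alt)
    ultimately have "aw True m \<circ> hword Rz (rev (alt False m)) = id"
      by (simp only: alt_add hword_append alt)
    then have "(aw True m \<circ> hword Rz (rev (alt False m))) \<circ> aw False m = aw False m"
      by simp
    then show ?thesis
      by (simp add: comp_assoc hword_rev)
  qed
  then show ?thesis by (cases b) auto
qed

text \<open>Words of odd length are conjugates of a generator, seen by peeling equal letters off
  both ends. Words of even length are powers of st or their inverses.\<close>

lemma aw_neq_id:
  assumes "0 < n" "n < 2 * m"
  shows "aw b n \<noteq> id"
proof (cases "even n")
  case False
  have "aw b (Suc (2 * k)) \<noteq> id" for k b
  proof (induction k arbitrary: b)
    case 0
    then show ?case using hact_neq_id[of b] by (simp add: id_def)
  next
    case (Suc k)
    have "alt b (Suc (2 * Suc k)) = b # alt (\<not> b) (Suc (2 * k)) @ [b]"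
      using alt_add[of "\<not> b" "Suc (2 * k)" 1] by simp
    then have conj: "aw b (Suc (2 * Suc k)) = hact Rz b \<circ> aw (\<not> b) (Suc (2 * k)) \<circ> hact Rz b"
      by (simp add: hword_append comp_assoc del: alt.simps)
    have conj': "hact Rz b \<circ> (hact Rz b \<circ> aw (\<not> b) (Suc (2 * k)) \<circ> hact Rz b) \<circ> hact Rz b = aw (\<not> b) (Suc (2 * k))"
      using pointfree_idE[OF hact_involution[of b]] by (simp add: comp_def)
    show ?case
    proof
      assume "aw b (Suc (2 * Suc k)) = id"
      then have "aw (\<not> b) (Suc (2 * k)) = id"
        using conj' unfolding conj by (simp only: comp_id hact_involution)
      then show False using Suc[of "\<not> b"] by (rule notE[rotated])
    qed
  qed
  then show ?thesis using False by (metis oddE Suc_eq_plus1)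
next
  case True
  then obtain k where n: "n = 2 * k" by blast
  have T: "aw True n \<noteq> id"
    using realization assms unfolding n aw_True_even by (simp add: dihedral_realization_def)
  have "rev (alt False n) = alt True n"
    using True by (simp add: rev_alt)
  then have "aw True n \<circ> aw False n = id"
    using hword_rev(1)[of "alt False n"] by simp
  then show ?thesis
    using T by (cases b) auto
qed

text \<open>With equal first letters the common prefix cancels; with different ones the inverse of
  one word joins the other into an alternating word of length k + l. Excluding k = l = m keeps that
  length below 2m.\<close>

lemma aw_inj_le:
  assumes "aw b k = aw c l" "k \<le> l" "l \<le> m" "\<not> (k = m \<and> l = m)"
  shows "k = l \<and> (k = 0 \<or> b = c)"
proof (cases "b = c \<or> k = 0")
  case True
  have "aw c l = aw c k \<circ> aw (if even k then c else \<not> c) (l - k)"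
    using alt_add[of c k "l - k"] assms(2) by (simp add: hword_append)
  moreover have "aw b k = aw c k" using True by auto
  ultimately have "aw c k \<circ> id = aw c k \<circ> aw (if even k then c else \<not> c) (l - k)"
    using assms(1) by simp
  then have "aw (if even k then c else \<not> c) (l - k) = id"
    by (metis hword_cancel)
  then have "l - k = 0"
    using aw_neq_id[of "l - k"] assms m_ge_2 by fastforce
  then show ?thesis using True assms(2) by auto
next
  case False
  \<comment> \<open>\<open>d\<close> is the first letter of the reversed word of length
    \<open>k\<close>.\<close>
  define d where "d = (if odd k then b else \<not> b)"
  have "alt d (k + l) = alt d k @ alt c l"
    using alt_add[of d k l] False by (auto simp: d_def)
  also have "alt d k = rev (alt b k)"
    by (simp add: rev_alt d_def)
  finally have "aw d (k + l) = hword Rz (rev (alt b k)) \<circ> aw b k"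
    using assms(1) by (simp add: hword_append)
  then have "aw d (k + l) = id"
    by (simp add: hword_rev)
  then show ?thesis
    using aw_neq_id[of "k + l" d] assms False by auto
qed

lemma aw_inj:
  assumes "aw b k = aw c l" "k \<le> m" "l \<le> m" "\<not> (k = m \<and> l = m)"
  shows "k = l \<and> (k = 0 \<or> b = c)"
  using aw_inj_le[of b k c l] aw_inj_le[of c l b k] assms by (cases "k \<le> l") auto

text \<open>A new letter in front cancels or extends an alternating word; at length m the braid
  relation first rewrites the word so that the letter cancels.\<close>

lemma hword_reduce: "\<exists>b n. n \<le> length w \<and> n \<le> m \<and> hword Rz w = aw b n"
proof (induction w)
  case Nil
  then show ?case by (intro exI[of _ True] exI[of _ 0]) simp
next
  case (Cons c w)
  then obtain b n where bn: "n \<le> length w" "n \<le> m" "hword Rz w = aw b n" by blast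
  have cancel: "hact Rz c \<circ> aw c (Suc l) = aw (\<not> c) l" for l
    using hact_involution[of c] by (simp add: comp_assoc[symmetric])
  consider "n = 0" | l where "n = Suc l" "b = c" | "b \<noteq> c" "n < m" | "b \<noteq> c" "n = m"
    using bn(2) by (metis le_neq_implies_less not0_implies_Suc)
  then show ?case
  proof cases
    case 1
    then have "hword Rz (c # w) = aw c 1" using bn by simp
    then show ?thesis using m_ge_2 by (intro exI[of _ c] exI[of _ 1]) auto
  next
    case (2 l)
    then have "hword Rz (c # w) = aw (\<not> c) l" using bn cancel by simp
    then show ?thesis using bn 2 by (intro exI[of _ "\<not> c"] exI[of _ l]) auto
  next
    case 3
    then have "hword Rz (c # w) = aw c (Suc n)" using bn by simp
    then show ?thesis using bn 3 by (intro exI[of _ c] exI[of _ "Suc n"]) auto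
  next
    case 4
    obtain l where l: "m = Suc l" using m_ge_2 by (cases m) auto
    have "aw b n = aw c m" using 4 aw_braid[of c] by simp
    then have "hword Rz (c # w) = aw (\<not> c) l"
      using bn(3) cancel[of l] l by simp
    then show ?thesis using bn 4 l by (intro exI[of _ "\<not> c"] exI[of _ l]) auto
  qed
qed

lemma wlen_aw:
  assumes "k \<le> m" shows "wlen Rz (aw b k) = k"
  unfolding wlen_def
proof (rule Least_equality)
  show "\<exists>w. length w = k \<and> hword Rz w = aw b k"
    by (intro exI[of _ "alt b k"]) simp
  fix y assume "\<exists>w. length w = y \<and> hword Rz w = aw b k"
  then obtain w where w: "length w = y" "hword Rz w = aw b k" by blast
  moreover obtain c n where "n \<le> length w" "n \<le> m" "hword Rz w = aw c n"
    using hword_reduce[of w] by blast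
  ultimately have "n \<le> y" "n \<le> m" "aw c n = aw b k" by auto
  then show "k \<le> y" using aw_inj[of c n b k] assms by auto
qed

text \<open>Enumerates the group so that twice the length of the \<open>n\<close>-th element is the degree of \<open>E u n\<close>.\<close>
definition welem :: "nat \<Rightarrow> ('n \<Rightarrow> 'k) \<Rightarrow> ('n \<Rightarrow> 'k)" where
  "welem n = aw (even n) (n div 2 + n mod 2)"

lemma welem_length_le: "n < 2 * m \<Longrightarrow> n div 2 + n mod 2 \<le> m"
  by presburger

lemma bij_welem: "bij_betw welem {..<2 * m} (Wgrp Rz)"
  unfolding bij_betw_def
proof
  show "inj_on welem {..<2 * m}"
  proof (rule inj_onI)
    fix i j assume ij: "i \<in> {..<2 * m}" "j \<in> {..<2 * m}" and eq: "welem i = welem j"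
    show "i = j"
    proof (cases "i div 2 + i mod 2 = m \<and> j div 2 + j mod 2 = m")
      case True
      \<comment> \<open>The longest element has two alternating words but only one index.\<close>
      have "n = 2 * m - 1" if "n < 2 * m" "n div 2 + n mod 2 = m" for n
        using that by (cases "even n") (auto elim!: evenE oddE)
      from this[of i] this[of j] have "i = 2 * m - 1" "j = 2 * m - 1" using ij True by simp_all
      then show ?thesis by simp
    next
      case False
      then have *: "i div 2 + i mod 2 = j div 2 + j mod 2 \<and> (i div 2 + i mod 2 = 0 \<or> even i = even j)"
        using ij eq by (intro aw_inj) (auto simp: welem_def welem_length_le)
      show ?thesis
      proof (cases "even i = even j")
        case True
        then have "i mod 2 = j mod 2" by presburger
        then show ?thesis using * by (metis add_right_cancel div_mult_mod_eq)
      next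
        case False
        with * have "i div 2 + i mod 2 = 0" "j div 2 + j mod 2 = 0" by auto
        then have "i mod 2 = 0" "j mod 2 = 0" by simp_all
        then show ?thesis using False by (simp add: even_iff_mod_2_eq_zero)
      qed
    qed
  qed
  show "welem ` {..<2 * m} = Wgrp Rz"
  proof
    show "welem ` {..<2 * m} \<subseteq> Wgrp Rz"
      by (auto simp: welem_def Wgrp_def)
    show "Wgrp Rz \<subseteq> welem ` {..<2 * m}"
    proof
      fix g assume "g \<in> Wgrp Rz"
      then obtain w where "g = hword Rz w"
        unfolding Wgrp_def by blast
      then obtain b n where g: "n \<le> m" "g = aw b n"
        using hword_reduce[of w] by blast
      have W: "welem (2 * l) = aw True l" "welem (Suc (2 * l)) = aw False (Suc l)" for l
        by (simp_all add: welem_def)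
      \<comment> \<open>Words starting with s sit at even and those starting with t at odd indices;
        the longest element is rewritten to start with t.\<close>
      consider "n = 0" | "b" "n < m" | l where "g = aw False n" "n = Suc l"
        using g aw_braid[of True] by (cases b; cases n) (auto simp: le_less)
      then show "g \<in> welem ` {..<2 * m}"
      proof cases
        case 1
        then show ?thesis using g W(1)[of 0] m_ge_2 by (intro image_eqI[of _ _ 0]) auto
      next
        case 2
        then show ?thesis using g W(1)[of n] by (intro image_eqI[of _ _ "2 * n"]) auto
      next
        case (3 l)
        then show ?thesis using g W(2)[of l] by (intro image_eqI[of _ _ "Suc (2 * l)"]) auto
      qed
    qed
  qed
qed

section \<open>Graded ranks and the Poincare polynomial of W\<close>

lemma poincW_eq: "poincW Rz m j = int (card {n. n < 2 * m \<and> 2 * int (n div 2 + n mod 2) - int m = j})"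
proof -
  have len: "wlen Rz (welem n) = n div 2 + n mod 2" if "n < 2 * m" for n
    unfolding welem_def using welem_length_le[OF that] by (rule wlen_aw)
  let ?N = "{n. n < 2 * m \<and> 2 * int (n div 2 + n mod 2) - int m = j}"
  have "{g \<in> Wgrp Rz. 2 * int (wlen Rz g) - int m = j} = welem ` ?N"
  proof (intro equalityI subsetI)
    fix g assume g: "g \<in> {g \<in> Wgrp Rz. 2 * int (wlen Rz g) - int m = j}"
    then obtain n where "n < 2 * m" "g = welem n"
      using bij_betw_imp_surj_on[OF bij_welem] by blast
    then show "g \<in> welem ` ?N"
      using g len[of n] by simp
  next
    fix g assume "g \<in> welem ` ?N"
    then obtain n where "n \<in> ?N" "g = welem n" by blast
    then show "g \<in> {g \<in> Wgrp Rz. 2 * int (wlen Rz g) - int m = j}"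
      using len[of n] bij_betw_imp_surj_on[OF bij_welem] by auto
  qed
  moreover have "inj_on welem ?N"
    using bij_welem by (auto simp: bij_betw_def intro: inj_on_subset)
  ultimately show ?thesis
    by (simp add: poincW_def card_image)
qed

lemma grk_R: "grk (2 * m) (\<lambda>n. 2 * (int (n div 2) + int (n mod 2))) (int m) = poincW Rz m"
  by (simp add: fun_eq_iff grk_def poincW_eq)

lemma card_bounded_eq_sum: "card {n. n < N \<and> Q n} = (\<Sum>n<N. if Q n then 1 else 0)" for N :: nat
proof -
  have "(\<Sum>n<N. if Q n then 1 else 0) = (\<Sum>n\<in>{n. n < N \<and> Q n}. 1 :: nat)"
    by (rule sum.mono_neutral_cong_right) auto
  then show ?thesis by simp
qed

text \<open>The elements of W with indices 2i and 2i + 1 have lengths i and i + 1. This pairing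
  realises the factor v + v^(-1), which is multiplied across because Laurent polynomials are
  coefficient functions here.\<close>

lemma grk_Ru: "mul_vvinv (grk m (\<lambda>i. 2 * int i) (int m - 1)) = poincW Rz m"
proof
  fix j
  have "card {n. n < 2 * m \<and> 2 * int (n div 2 + n mod 2) - int m = j} =
      (\<Sum>i<m. (if 2 * int i - (int m - 1) = j + 1 then 1 else 0) + (if 2 * int i - (int m - 1) = j - 1 then 1 else 0))"
    unfolding card_bounded_eq_sum sum_pairs by (intro sum.cong refl arg_cong2[of _ _ _ _ "(+)"]) auto
  also have "\<dots> = card {i. i < m \<and> 2 * int i - (int m - 1) = j + 1} + card {i. i < m \<and> 2 * int i - (int m - 1) = j - 1}"
    unfolding card_bounded_eq_sum by (rule sum.distrib)
  finally show "mul_vvinv (grk m (\<lambda>i. 2 * int i) (int m - 1)) j = poincW Rz m j"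
    by (simp add: mul_vvinv_def grk_def poincW_eq)
qed

end

theorem theorem3p32:
  fixes Rz :: "('n::finite, 'k::comm_ring_1) rlz" and q :: 'k and m :: nat
  assumes "dihedral_realization Rz q m"
  defines "RW \<equiv> Rinv Rz {True, False}" and "Rs \<equiv> Rinv Rz {True}" and "Rt \<equiv> Rinv Rz {False}"
  shows
    "frob_square RW Rs Rt UNIV (dem Rz True) (dem Rz False) (dsW Rz m) (dtW Rz m) (dW Rz m)
   \<and> (\<exists>r b d. free_graded RW UNIV r b d \<and> grk r d (int m) = poincW Rz m)
   \<and> (\<forall>u. \<exists>r b d. free_graded RW (Rinv Rz {u}) r b d \<and>
                   mul_vvinv (grk r d (int m - 1)) = poincW Rz m)
   \<and> (\<forall>r f g. dual_bases RW UNIV (dW Rz m) r f g \<longrightarrow> (\<Sum>i<r. f i * g i) = Lambda Rz m)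
   \<and> dW Rz m (Lambda Rz m) = of_nat (2 * m)
   \<and> (\<forall>r f g. dual_bases RW Rs (dsW Rz m) r f g \<longrightarrow>
          (\<Sum>i<r. f i * g i) = pdiv (Lambda Rz m) (lin (root Rz True)))
   \<and> (\<forall>r f g. dual_bases RW Rs (dsW Rz m) r f g \<longrightarrow>
          dsW Rz m (\<Sum>i<r. f i * g i) = of_nat m)
   \<and> (\<forall>r f g. dual_bases RW Rs (dsW Rz m) r f g \<longrightarrow>
          (\<Sum>i<r. f i * dem Rz False (g i)) = pdiv (Lambda Rz m) (lin (root Rz True) * lin (root Rz False))
        \<and> (\<Sum>i<r. dem Rz False (f i) * g i) = pdiv (Lambda Rz m) (lin (root Rz True) * lin (root Rz False)))
   \<and> (\<forall>rs fs gs rt ft gt. dual_bases RW Rs (dsW Rz m) rs fs gs \<longrightarrow> dual_bases RW Rt (dtW Rz m) rt ft gt \<longrightarrow>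
        (\<forall>f. teq RW Rs Rt (map (\<lambda>i. (fs i, dem Rz False (f * gs i))) [0..<rs])
                          (map (\<lambda>j. (dem Rz True (f * ft j), gt j)) [0..<rt])))
   \<and> (\<forall>rs fs gs. dual_bases RW Rs (dsW Rz m) rs fs gs \<longrightarrow>
        (\<forall>f f'. teq RW Rs Rt (map (\<lambda>i. (fs i, dem Rz False ((f + f') * gs i))) [0..<rs])
                  (map (\<lambda>i. (fs i, dem Rz False (f * gs i))) [0..<rs] @
                   map (\<lambda>i. (fs i, dem Rz False (f' * gs i))) [0..<rs]))
      \<and> (\<forall>f a. a \<in> Rs \<longrightarrow> teq RW Rs Rt (map (\<lambda>i. (fs i, dem Rz False (a * f * gs i))) [0..<rs])
                  (map (\<lambda>i. (a * fs i, dem Rz False (f * gs i))) [0..<rs]))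
      \<and> (\<forall>f c. c \<in> Rt \<longrightarrow> teq RW Rs Rt (map (\<lambda>i. (fs i, dem Rz False (f * c * gs i))) [0..<rs])
                  (map (\<lambda>i. (fs i, dem Rz False (f * gs i) * c)) [0..<rs])))"
proof -
  interpret dihedral Rz q m
    using assms(1) by unfold_locales
  have Rs: "Rs = Ru True" and Rt: "Rt = Ru False"
    by (simp_all add: Rs_def Rt_def)
  have dW: "dW Rz m = full True"
    by (simp add: fun_eq_iff full_eq_dW)
  have 1: "frob_square RW Rs Rt UNIV (dem Rz True) (dem Rz False) (dsW Rz m) (dtW Rz m) (dW Rz m)"
    unfolding RW_def Rs_def Rt_def by (rule frob_square_dihedral)
  have 2: "\<exists>r b d. free_graded RW UNIV r b d \<and> grk r d (int m) = poincW Rz m"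
    unfolding RW_def using free_graded_R grk_R by blast
  have 3: "\<forall>u. \<exists>r b d. free_graded RW (Rinv Rz {u}) r b d \<and> mul_vvinv (grk r d (int m - 1)) = poincW Rz m"
    unfolding RW_def using free_graded_Ru grk_Ru by blast
  have 4: "(\<Sum>i<r. f i * g i) = Lambda Rz m" if "dual_bases RW UNIV (dW Rz m) r f g" for r f g
    using dual_bases_full_sum[of True] that by (simp add: RW_def dW alpha_Lambda_sub)
  have 5: "dW Rz m (Lambda Rz m) = of_nat (2 * m)"
    using full_Lambda[of True] by (simp add: dW alpha_Lambda_sub)
  have 6: "(\<Sum>i<r. f i * g i) = pdiv (Lambda Rz m) (lin (root Rz True))"
    and 9: "dsW Rz m (\<Sum>i<r. f i * g i) = of_nat m"
    and 10: "(\<Sum>i<r. f i * dem Rz False (g i)) = pdiv (Lambda Rz m) (lin (root Rz True) * lin (root Rz False))"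
    and 11: "(\<Sum>i<r. dem Rz False (f i) * g i) = pdiv (Lambda Rz m) (lin (root Rz True) * lin (root Rz False))"
    if "dual_bases RW Rs (dsW Rz m) r f g" for r f g
  proof -
    have db: "dual_bases (Rinv Rz {True, False}) (Ru True) (tr True) r f g"
      using that by (simp add: RW_def Rs tr_eq_dsW)
    show "(\<Sum>i<r. f i * g i) = pdiv (Lambda Rz m) (lin (root Rz True))"
      using dual_bases_tr_sum[OF db] by (simp add: pdiv_Lambda_alpha)
    show "dsW Rz m (\<Sum>i<r. f i * g i) = of_nat m"
      using dual_bases_tr_sum[OF db] tr_Lambda_sub[of True] by (simp add: tr_eq_dsW)
    show "(\<Sum>i<r. f i * dem Rz False (g i)) = pdiv (Lambda Rz m) (lin (root Rz True) * lin (root Rz False))"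
      using pdiv_Lambda_alpha_alpha dual_bases_tr_D_right[OF db] by simp
    show "(\<Sum>i<r. dem Rz False (f i) * g i) = pdiv (Lambda Rz m) (lin (root Rz True) * lin (root Rz False))"
      using pdiv_Lambda_alpha_alpha dual_bases_tr_D_left[OF db] by simp
  qed
  have 7: "teq RW Rs Rt (map (\<lambda>i. (fs i, dem Rz False (f * gs i))) [0..<rs])
      (map (\<lambda>j. (dem Rz True (f * ft j), gt j)) [0..<rt])"
    if "dual_bases RW Rs (dsW Rz m) rs fs gs" "dual_bases RW Rt (dtW Rz m) rt ft gt" for rs fs gs rt ft gt f
    using comult_exchange[of True rs fs gs rt ft gt f] that
    by (simp add: RW_def Rs Rt tr_eq_dsW tr_eq_dtW)
  have 8: "teq RW Rs Rt (map (\<lambda>i. (fs i, dem Rz False ((f + f') * gs i))) [0..<rs])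
      (map (\<lambda>i. (fs i, dem Rz False (f * gs i))) [0..<rs] @
       map (\<lambda>i. (fs i, dem Rz False (f' * gs i))) [0..<rs])"
    and 12: "a \<in> Rs \<Longrightarrow> teq RW Rs Rt (map (\<lambda>i. (fs i, dem Rz False (a * f * gs i))) [0..<rs])
      (map (\<lambda>i. (a * fs i, dem Rz False (f * gs i))) [0..<rs])"
    and 13: "c \<in> Rt \<Longrightarrow> teq RW Rs Rt (map (\<lambda>i. (fs i, dem Rz False (f * c * gs i))) [0..<rs])
      (map (\<lambda>i. (fs i, dem Rz False (f * gs i) * c)) [0..<rs])"
    if "dual_bases RW Rs (dsW Rz m) rs fs gs" for rs fs gs f f' a c
    using that comult_add[of True rs fs gs False f f'] comult_left_linear[of True rs fs gs a False f]
      comult_right_linear[of True rs fs gs c False f]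
    by (simp_all add: RW_def Rs Rt tr_eq_dsW)
  show ?thesis
    by (intro conjI 1 2 3 5 allI impI) (assumption | rule 4 6 7 8 9 10 11 12 13)+
qed

end
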